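(* Let $F(\tau)=\sum_{n\ge1}a_ne^{2\pi in\tau}$ and $G(\tau)=\sum_{n\ge1}b_ne^{2\pi in\tau}$ be holomorphic cusp forms of even weight for $SL_2(\mathbb{Z})$, and let $s_1,s_2$ be complex numbers with real parts large enough that $\sum_{0<n_1<n_2}\frac{|a_{n_1}b_{n_2}|}{|n_1^{s_1}n_2^{s_2}|}<\infty$. Define functions $f_f,g_f$ on $\mathbb{A}_f^\times$ by $f_f(x)=a_n$ and $g_f(x)=b_n$ if $x\in n\hat{\mathbb{Z}}^\times$ for a positive integer $n$, and $f_f(x)=g_f(x)=0$ if $x$ lies in no such set. Let $$I(s_1,s_2)=\int_{\substack{(x_1,x_2)\in(\mathbb{A}_f^\times)^2\\ |x_1|_f>|x_2|_f}} f_f(x_1)\,|x_1|_f^{s_1}\, g_f(x_2)\,|x_2|_f^{s_2}\; d_f^\times x_1\, d_f^\times x_2 .$$ Then $I(s_1,s_2)=L(F,G,s_1,s_2)$, where $$L(F,G,s_1,s_2)=\sum_{0<n_1<n_2}\frac{a_{n_1}b_{n_2}}{n_1^{s_1}n_2^{s_2}}.$$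
   Context: $\mathbb{A}_f^\times$ denotes the group of finite ideles of $\mathbb{Q}$, i.e. the restricted product of the groups $\mathbb{Q}_p^\times$ over all primes $p$ with respect to the subgroups $\mathbb{Z}_p^\times$. $\hat{\mathbb{Z}}=\prod_p\mathbb{Z}_p$, $\hat{\mathbb{Z}}^\times=\prod_p\mathbb{Z}_p^\times$, and for a positive integer $n$, $n\hat{\mathbb{Z}}^\times=\{nu:u\in\hat{\mathbb{Z}}^\times\}$. For $x=(x_p)_p\in\mathbb{A}_f^\times$ put $|x|_f=\prod_p|x_p|_p$, where $|\cdot|_p$ is the normalized $p$-adic absolute value with $|p|_p=p^{-1}$. The measure $d_f^\times x=\prod_p d_p^\times x_p$ is the product of the Haar measures on $\mathbb{Q}_p^\times$, each normalized so that $\mathbb{Z}_p^\times$ has measure $1$. *)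

theory Defs
  imports
    "HOL-Analysis.Analysis"
    "HOL-Computational_Algebra.Computational_Algebra"
    "HOL-Algebra.QuotRing"
begin

definition upper_half_plane :: "complex set" where
  "upper_half_plane = {\<tau>. Im \<tau> > 0}"

definition cusp_form :: "int \<Rightarrow> (complex \<Rightarrow> complex) \<Rightarrow> bool" where
  "cusp_form k F \<longleftrightarrow>
     F holomorphic_on upper_half_plane \<and>
     (\<forall>a b c d :: int. a * d - b * c = 1 \<longrightarrow>
        (\<forall>\<tau>\<in>upper_half_plane.
           F ((of_int a * \<tau> + of_int b) / (of_int c * \<tau> + of_int d)) =
             (of_int c * \<tau> + of_int d) powi k * F \<tau>)) \<and>
     (F \<longlongrightarrow> 0) (filtercomap Im at_top)"


definition padic_val :: "nat \<Rightarrow> rat \<Rightarrow> int" where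
  "padic_val p q =
     int (multiplicity (int p) (fst (quotient_of q))) -
     int (multiplicity (int p) (snd (quotient_of q)))"

definition padic_abs_rat :: "nat \<Rightarrow> rat \<Rightarrow> real" where
  "padic_abs_rat p q = (if q = 0 then 0 else real p powi (- padic_val p q))"

definition padic_Cauchy :: "nat \<Rightarrow> (nat \<Rightarrow> rat) \<Rightarrow> bool" where
  "padic_Cauchy p X \<longleftrightarrow>
     (\<forall>e>0. \<exists>N. \<forall>m\<ge>N. \<forall>n\<ge>N. padic_abs_rat p (X m - X n) < e)"

definition padic_Cauchy_ring :: "nat \<Rightarrow> (nat \<Rightarrow> rat) ring" where
  "padic_Cauchy_ring p =
     \<lparr>carrier = {X. padic_Cauchy p X},
      monoid.mult = (\<lambda>X Y n. X n * Y n), one = (\<lambda>n. 1),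
      zero = (\<lambda>n. 0), add = (\<lambda>X Y n. X n + Y n)\<rparr>"

definition padic_null :: "nat \<Rightarrow> (nat \<Rightarrow> rat) set" where
  "padic_null p = {X. (\<lambda>n. padic_abs_rat p (X n)) \<longlonglongrightarrow> 0}"

text \<open>A \<open>p\<close>-adic number is an equivalence class of Cauchy sequences of rationals. As a type cannot
  depend on \<open>p\<close>, the fields \<open>\<rat>\<^sub>p\<close> for the various \<open>p\<close> share one type of elements.\<close>

type_synonym padic = "(nat \<Rightarrow> rat) set"

definition Qp :: "nat \<Rightarrow> padic ring" where
  "Qp p = padic_Cauchy_ring p Quot padic_null p"

definition padic_abs :: "nat \<Rightarrow> padic \<Rightarrow> real" where
  "padic_abs p x = (THE r. \<forall>X\<in>x. (\<lambda>n. padic_abs_rat p (X n)) \<longlonglongrightarrow> r)"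

text \<open>The value \<open>0\<close> off the carrier makes the function nonnegative and symmetric everywhere,
  which \<^locale>\<open>Metric_space\<close> demands.\<close>

definition padic_dist :: "nat \<Rightarrow> padic \<Rightarrow> padic \<Rightarrow> real" where
  "padic_dist p x y =
     (if x \<in> carrier (Qp p) \<and> y \<in> carrier (Qp p)
      then padic_abs p (x \<ominus>\<^bsub>Qp p\<^esub> y) else 0)"

definition Zp :: "nat \<Rightarrow> padic ring" where
  "Zp p = (Qp p)\<lparr>carrier := {x \<in> carrier (Qp p). padic_abs p x \<le> 1}\<rparr>"

text \<open>Inversion is continuous on the nonzero elements of \<open>\<rat>\<^sub>p\<close>, so the topology of the
  multiplicative group is the subspace topology.\<close>

definition Qp_units_topology :: "nat \<Rightarrow> padic topology" where
  "Qp_units_topology p =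
     subtopology (Metric_space.mtopology (carrier (Qp p)) (padic_dist p)) (Units (Qp p))"

text \<open>Left Haar measures: nonzero left-invariant Radon measures on the Borel sets.\<close>

definition is_haar_measure :: "('a, 'b) monoid_scheme \<Rightarrow> 'a topology \<Rightarrow> 'a measure \<Rightarrow> bool" where
  "is_haar_measure G T M \<longleftrightarrow>
     space M = topspace T \<and>
     sets M = sigma_sets (topspace T) {U. openin T U} \<and>
     emeasure M (space M) \<noteq> 0 \<and>
     (\<forall>g\<in>carrier G. \<forall>A\<in>sets M. emeasure M ((\<lambda>x. g \<otimes>\<^bsub>G\<^esub> x) ` A) = emeasure M A) \<and>
     (\<forall>K. compactin T K \<longrightarrow> emeasure M K < \<infinity>) \<and>
     (\<forall>A\<in>sets M. emeasure M A = (INF U\<in>{U. openin T U \<and> A \<subseteq> U}. emeasure M U)) \<and>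
     (\<forall>U. openin T U \<longrightarrow>
        emeasure M U = (SUP K\<in>{K. compactin T K \<and> K \<subseteq> U}. emeasure M K))"


definition fin_ideles :: "(nat \<Rightarrow> padic) set" where
  "fin_ideles =
     {x \<in> (\<Pi>\<^sub>E p\<in>{p. prime p}. Units (Qp p)). finite {p. prime p \<and> x p \<notin> Units (Zp p)}}"

definition Zhat_units :: "(nat \<Rightarrow> padic) set" where
  "Zhat_units = (\<Pi>\<^sub>E p\<in>{p. prime p}. Units (Zp p))"

definition nat_Zhat_units :: "nat \<Rightarrow> (nat \<Rightarrow> padic) set" where
  "nat_Zhat_units n = (\<lambda>u. \<lambda>p\<in>{p. prime p}. [n] \<cdot>\<^bsub>Qp p\<^esub> u p) ` Zhat_units"

definition fin_idele_abs :: "(nat \<Rightarrow> padic) \<Rightarrow> real" where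
  "fin_idele_abs x = (\<Prod>p | prime p \<and> padic_abs p (x p) \<noteq> 1. padic_abs p (x p))"

text \<open>The restricted product of measures \<open>\<nu> p\<close> on \<open>\<rat>\<^sub>p\<^sup>\<times>\<close> giving \<open>\<int>\<^sub>p\<^sup>\<times>\<close> measure \<open>1\<close>: the measure on the
  \<open>\<sigma>\<close>-algebra generated by the boxes \<open>\<Prod>\<^sub>p U p\<close> with \<open>U p = \<int>\<^sub>p\<^sup>\<times>\<close> for almost all \<open>p\<close> that assigns
  \<open>\<Prod>\<^sub>p \<nu> p (U p)\<close> to such a box.\<close>

definition fin_idele_measure :: "(nat \<Rightarrow> padic measure) \<Rightarrow> (nat \<Rightarrow> padic) measure" where
  "fin_idele_measure \<nu> =
     extend_measure fin_ideles
       {U. (\<forall>p. prime p \<longrightarrow> U p \<in> sets (\<nu> p)) \<and> finite {p. prime p \<and> U p \<noteq> Units (Zp p)}}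
       (\<lambda>U. \<Pi>\<^sub>E p\<in>{p. prime p}. U p)
       (\<lambda>U. \<Prod>p | prime p \<and> U p \<noteq> Units (Zp p). emeasure (\<nu> p) (U p))"

definition fin_idele_fun :: "(nat \<Rightarrow> complex) \<Rightarrow> (nat \<Rightarrow> padic) \<Rightarrow> complex" where
  "fin_idele_fun a x =
     (if \<exists>n>0. x \<in> nat_Zhat_units n then a (THE n. n > 0 \<and> x \<in> nat_Zhat_units n) else 0)"

end

theory Submission
  imports Defs "HOL-Probability.Infinite_Product_Measure"
begin

text \<open>Every unit of \<open>\<rat>\<^sub>p\<close> has absolute value \<open>p\<^sup>-\<^sup>k\<close> for some integer \<open>k\<close>, so the multiplicative group is the
  disjoint union of open shells, which are translates of the group of units of \<open>\<int>\<^sub>p\<close> and hence have Haar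
  measure \<open>1\<close>. Consequently the finite ideles are the disjoint union of the countably many products of
  shells with finitely supported exponent vectors \<open>k\<close>. Summing the infinite product probability
  measures on these cells yields a measure with the prescribed values on boxes, so the extended measure
  is not the junk value of \<^const>\<open>extend_measure\<close>. The set of multiples by \<open>n\<close> of the units of the profinite integers is
  the cell whose exponents are the multiplicities of the primes in \<open>n\<close>; it has measure \<open>1\<close>, and on it the idele norm is
  \<open>1 / n\<close>. Hence the integrand is a function of the levels \<open>(n\<^sub>1, n\<^sub>2)\<close>, and its integral is the double series.\<close>

subsection \<open>The \<open>p\<close>-adic numbers\<close>

text \<open>\<open>quotient_of\<close> returns lowest terms, while sums and products rarely come
  reduced. Cross-multiplying the reduced fraction with \<open>a / b\<close> gives
  \<open>a * d = c * b\<close>, and additivity of multiplicities does the rest.\<close>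

lemma padic_val_fraction:
  assumes p: "prime p" and a: "a \<noteq> 0" and b: "b \<noteq> 0"
  shows "padic_val p (of_int a / of_int b) =
    int (multiplicity (int p) a) - int (multiplicity (int p) b)"
proof -
  let ?q = "of_int a / of_int b :: rat"
  obtain c d where cd: "quotient_of ?q = (c, d)" by force
  have d: "d > 0" using quotient_of_denom_pos[OF cd] .
  have q: "?q = of_int c / of_int d" using quotient_of_div[OF cd] .
  have "?q \<noteq> 0" using a b by simp
  then have c: "c \<noteq> 0" using q by auto
  have "of_int a * of_int d = (of_int c * of_int b :: rat)"
    using q b d by (simp add: field_simps)
  then have eq: "a * d = c * b" by (metis of_int_eq_iff of_int_mult)
  have pp: "prime_elem (int p)" using p by simp
  have "multiplicity (int p) a + multiplicity (int p) d = multiplicity (int p) c + multiplicity (int p) b"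
    using prime_elem_multiplicity_mult_distrib[OF pp a, of d]
      prime_elem_multiplicity_mult_distrib[OF pp c b] d eq by auto
  then show ?thesis unfolding padic_val_def cd by simp
qed

text \<open>Over a common denominator the valuation of a sum can be compared on numerators alone,
  since the denominator shifts all three valuations equally.\<close>

lemma rat_common_denominator:
  fixes x y :: rat
  obtains a b d where "x = of_int a / of_int d" "y = of_int b / of_int d" "d \<noteq> (0::int)"
proof -
  obtain a d where x: "x = of_int a / of_int d" "d > 0"
    by (metis quotient_of_denom_pos quotient_of_div surj_pair)
  obtain b e where y: "y = of_int b / of_int e" "e > 0"
    by (metis quotient_of_denom_pos quotient_of_div surj_pair)
  show ?thesis
    by (rule that[of "a * e" "d * e" "b * d"]) (use x y in \<open>simp_all add: field_simps\<close>)
qed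

lemma padic_val_mult:
  assumes p: "prime p" and x: "x \<noteq> 0" and y: "y \<noteq> 0"
  shows "padic_val p (x * y) = padic_val p x + padic_val p y"
proof -
  obtain a b d where ab: "x = of_int a / of_int d" "y = of_int b / of_int d" "d \<noteq> 0"
    using rat_common_denominator .
  have nz: "a \<noteq> 0" "b \<noteq> 0" using ab x y by auto
  have pp: "prime_elem (int p)" using p by simp
  have "x * y = of_int (a * b) / of_int (d * d)" using ab by simp
  then have "padic_val p (x * y) =
      int (multiplicity (int p) (a * b)) - int (multiplicity (int p) (d * d))"
    using padic_val_fraction[OF p, of "a * b" "d * d"] nz ab by simp
  then show ?thesis
    using padic_val_fraction[OF p, of _ d] ab nz prime_elem_multiplicity_mult_distrib[OF pp] by simp
qed

lemma padic_val_add_ge: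
  assumes p: "prime p" and x: "x \<noteq> 0" and y: "y \<noteq> 0" and xy: "x + y \<noteq> 0"
  shows "padic_val p (x + y) \<ge> min (padic_val p x) (padic_val p y)"
proof -
  obtain a b d where ab: "x = of_int a / of_int d" "y = of_int b / of_int d" "d \<noteq> 0"
    using rat_common_denominator .
  have eq: "x + y = of_int (a + b) / of_int d" using ab by (simp add: add_divide_distrib)
  have nz: "a \<noteq> 0" "b \<noteq> 0" "a + b \<noteq> 0" using ab x y xy eq by auto
  let ?m = "\<lambda>z. multiplicity (int p) z"
  \<comment> \<open>The smaller of the two prime powers divides both numerators, hence their
    sum.\<close>
  have "int p ^ min (?m a) (?m b) dvd a + b"
    by (intro dvd_add multiplicity_dvd') simp_all
  then have "min (?m a) (?m b) \<le> ?m (a + b)"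
    using nz p by (intro multiplicity_geI) (auto simp: prime_gt_1_nat dest: prime_gt_1_nat)
  then show ?thesis
    using padic_val_fraction[OF p nz(1) ab(3)] padic_val_fraction[OF p nz(2) ab(3)]
      padic_val_fraction[OF p nz(3) ab(3)]
    unfolding ab(1,2) eq[unfolded ab(1,2)] by linarith
qed

lemma padic_abs_rat_0 [simp]: "padic_abs_rat p 0 = 0"
  by (simp add: padic_abs_rat_def)

lemma padic_abs_rat_1 [simp]: "padic_abs_rat p 1 = 1"
  by (simp add: padic_abs_rat_def padic_val_def)

lemma padic_abs_rat_nonneg [simp]: "padic_abs_rat p x \<ge> 0"
  by (simp add: padic_abs_rat_def)

lemma padic_abs_rat_mult:
  assumes "prime p" shows "padic_abs_rat p (x * y) = padic_abs_rat p x * padic_abs_rat p y"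
proof (cases "x = 0 \<or> y = 0")
  case False
  then have "- padic_val p (x * y) = - padic_val p x + - padic_val p y"
    using padic_val_mult[OF assms, of x y] by simp
  moreover have "real p \<noteq> 0" using assms by auto
  ultimately show ?thesis
    using False power_int_add[of "real p" "- padic_val p x" "- padic_val p y"]
    by (simp only: padic_abs_rat_def) simp
qed auto

lemma padic_abs_rat_uminus [simp]: "padic_abs_rat p (- x) = padic_abs_rat p x"
  by (cases "quotient_of x") (simp add: padic_abs_rat_def padic_val_def rat_uminus_code)

lemma padic_abs_rat_minus_commute: "padic_abs_rat p (x - y) = padic_abs_rat p (y - x)"
  by (metis minus_diff_eq padic_abs_rat_uminus)

lemma padic_abs_rat_add_le_max:
  assumes p: "prime p"
  shows "padic_abs_rat p (x + y) \<le> max (padic_abs_rat p x) (padic_abs_rat p y)"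
proof (cases "x = 0 \<or> y = 0 \<or> x + y = 0")
  case False
  then have "padic_val p (x + y) \<ge> padic_val p x \<or> padic_val p (x + y) \<ge> padic_val p y"
    using padic_val_add_ge[OF p, of x y] by auto
  then have "padic_abs_rat p (x + y) \<le> padic_abs_rat p x \<or> padic_abs_rat p (x + y) \<le> padic_abs_rat p y"
    using False prime_ge_1_nat[OF p] by (auto simp: padic_abs_rat_def intro!: power_int_increasing)
  then show ?thesis by auto
qed (auto simp: le_max_iff_disj)

lemma padic_abs_rat_add_le:
  "prime p \<Longrightarrow> padic_abs_rat p (x + y) \<le> padic_abs_rat p x + padic_abs_rat p y"
  using padic_abs_rat_add_le_max[of p x y] padic_abs_rat_nonneg[of p x] padic_abs_rat_nonneg[of p y]
  by linarith

text \<open>Two uses of the ultrametric inequality: the difference is smaller than \<open>x\<close>,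
  so it can neither lift \<open>y\<close> above \<open>x\<close> nor make up for a \<open>y\<close>
  smaller than \<open>x\<close>.\<close>

lemma padic_abs_rat_isosceles:
  assumes "prime p" "padic_abs_rat p (y - x) < padic_abs_rat p x"
  shows "padic_abs_rat p y = padic_abs_rat p x"
proof -
  have "padic_abs_rat p y \<le> max (padic_abs_rat p (y - x)) (padic_abs_rat p x)"
    using padic_abs_rat_add_le_max[OF assms(1), of "y - x" x] by simp
  moreover have "padic_abs_rat p x \<le> max (padic_abs_rat p (y - x)) (padic_abs_rat p y)"
    using padic_abs_rat_add_le_max[OF assms(1), of "x - y" y]
    by (simp add: padic_abs_rat_minus_commute[of p x y])
  ultimately show ?thesis using assms(2) by linarith
qed

lemma padic_abs_rat_diff_bound:
  assumes "prime p"
  shows "\<bar>padic_abs_rat p x - padic_abs_rat p y\<bar> \<le> padic_abs_rat p (x - y)"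
  using padic_abs_rat_add_le[OF assms, of "x - y" y] padic_abs_rat_add_le[OF assms, of "y - x" x]
  by (simp add: padic_abs_rat_minus_commute[of p y x])

section \<open>Cauchy sequences and null sequences of rationals\<close>

text \<open>A Cauchy sequence that is not null has absolute value at least some \<open>e > 0\<close>
  infinitely often. Once its differences fall below \<open>e\<close>, the isosceles property freezes
  the absolute value at that of a nonzero rational. This is the source of the discrete value
  group.\<close>

lemma padic_Cauchy_abs_tendsto:
  assumes p: "prime p" and X: "padic_Cauchy p X"
  obtains "X \<in> padic_null p" | k where "(\<lambda>n. padic_abs_rat p (X n)) \<longlonglongrightarrow> real p powi k"
proof (cases "X \<in> padic_null p")
  case False
  then obtain e where e: "e > 0" "\<And>N. \<exists>n\<ge>N. padic_abs_rat p (X n) \<ge> e"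
    unfolding padic_null_def LIMSEQ_def by (force simp: not_less)
  obtain N where N: "\<And>m n. m \<ge> N \<Longrightarrow> n \<ge> N \<Longrightarrow> padic_abs_rat p (X m - X n) < e"
    using X e(1) unfolding padic_Cauchy_def by blast
  obtain n0 where n0: "n0 \<ge> N" "padic_abs_rat p (X n0) \<ge> e" using e(2) by blast
  have "padic_abs_rat p (X n) = padic_abs_rat p (X n0)" if "n \<ge> N" for n
    using N[OF that n0(1)] n0(2) by (intro padic_abs_rat_isosceles[OF p]) simp
  then have "\<forall>\<^sub>F n in sequentially. padic_abs_rat p (X n) = padic_abs_rat p (X n0)"
    using eventually_sequentially by blast
  then have lim: "(\<lambda>n. padic_abs_rat p (X n)) \<longlonglongrightarrow> padic_abs_rat p (X n0)"
    by (rule tendsto_eventually)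
  have "X n0 \<noteq> 0" using n0(2) e(1) by auto
  then show ?thesis using that(2) lim by (simp add: padic_abs_rat_def)
qed (rule that(1))

lemma padic_Cauchy_abs_convergent:
  "prime p \<Longrightarrow> padic_Cauchy p X \<Longrightarrow> convergent (\<lambda>n. padic_abs_rat p (X n))"
  by (erule (1) padic_Cauchy_abs_tendsto) (auto simp: convergent_def padic_null_def)

lemma padic_Cauchy_const: "padic_Cauchy p (\<lambda>n. q)"
  by (simp add: padic_Cauchy_def)

lemma padic_Cauchy_add:
  assumes p: "prime p" and X: "padic_Cauchy p X" and Y: "padic_Cauchy p Y"
  shows "padic_Cauchy p (\<lambda>n. X n + Y n)"
  unfolding padic_Cauchy_def
proof (intro allI impI)
  fix e :: real assume e: "e > 0"
  obtain N where N: "\<And>m n. m \<ge> N \<Longrightarrow> n \<ge> N \<Longrightarrow> padic_abs_rat p (X m - X n) < e"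
    using X e unfolding padic_Cauchy_def by blast
  obtain M where M: "\<And>m n. m \<ge> M \<Longrightarrow> n \<ge> M \<Longrightarrow> padic_abs_rat p (Y m - Y n) < e"
    using Y e unfolding padic_Cauchy_def by blast
  have "padic_abs_rat p (X m + Y m - (X n + Y n)) < e" if "m \<ge> max N M" "n \<ge> max N M" for m n
  proof -
    have "padic_abs_rat p ((X m - X n) + (Y m - Y n)) < e"
      using padic_abs_rat_add_le_max[OF p, of "X m - X n" "Y m - Y n"] N[of m n] M[of m n] that by auto
    then show ?thesis by (simp add: algebra_simps)
  qed
  then show "\<exists>N. \<forall>m\<ge>N. \<forall>n\<ge>N. padic_abs_rat p (X m + Y m - (X n + Y n)) < e" by blast
qed

lemma padic_Cauchy_uminus: "padic_Cauchy p X \<Longrightarrow> padic_Cauchy p (\<lambda>n. - X n)"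
  unfolding padic_Cauchy_def by (simp add: padic_abs_rat_minus_commute)

lemma padic_Cauchy_mult:
  assumes p: "prime p" and X: "padic_Cauchy p X" and Y: "padic_Cauchy p Y"
  shows "padic_Cauchy p (\<lambda>n. X n * Y n)"
  unfolding padic_Cauchy_def
proof (intro allI impI)
  fix e :: real assume e: "e > 0"
  \<comment> \<open>In a product each error is multiplied by the other factor. The absolute values
    converge and so are bounded, which fixes the tolerances \<open>e / C\<close> and
    \<open>e / B\<close>; the ultrametric inequality then bounds the sum of both errors by
    \<open>e\<close> without halving.\<close>
  obtain B where B: "B > 0" "\<And>n. padic_abs_rat p (X n) \<le> B"
    using convergent_imp_Bseq[OF padic_Cauchy_abs_convergent[OF p X]] by (auto elim!: BseqE)
  obtain C where C: "C > 0" "\<And>n. padic_abs_rat p (Y n) \<le> C"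
    using convergent_imp_Bseq[OF padic_Cauchy_abs_convergent[OF p Y]] by (auto elim!: BseqE)
  obtain N where N: "\<And>m n. m \<ge> N \<Longrightarrow> n \<ge> N \<Longrightarrow> padic_abs_rat p (X m - X n) < e / C"
    using X e C(1) unfolding padic_Cauchy_def by (meson divide_pos_pos)
  obtain M where M: "\<And>m n. m \<ge> M \<Longrightarrow> n \<ge> M \<Longrightarrow> padic_abs_rat p (Y m - Y n) < e / B"
    using Y e B(1) unfolding padic_Cauchy_def by (meson divide_pos_pos)
  have "padic_abs_rat p (X m * Y m - X n * Y n) < e" if "m \<ge> max N M" "n \<ge> max N M" for m n
  proof -
    have "padic_abs_rat p (X m) * padic_abs_rat p (Y m - Y n) \<le> B * padic_abs_rat p (Y m - Y n)"
      by (intro mult_right_mono B) simp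
    also have "\<dots> < e" using M[of m n] that B(1) by (simp add: field_simps)
    finally have 1: "padic_abs_rat p (X m * (Y m - Y n)) < e" by (simp add: padic_abs_rat_mult[OF p])
    have "padic_abs_rat p (X m - X n) * padic_abs_rat p (Y n) \<le> padic_abs_rat p (X m - X n) * C"
      by (intro mult_left_mono C) simp
    also have "\<dots> < e" using N[of m n] that C(1) by (simp add: field_simps)
    finally have 2: "padic_abs_rat p ((X m - X n) * Y n) < e" by (simp add: padic_abs_rat_mult[OF p])
    have "padic_abs_rat p (X m * (Y m - Y n) + (X m - X n) * Y n) < e"
      using padic_abs_rat_add_le_max[OF p, of "X m * (Y m - Y n)" "(X m - X n) * Y n"] 1 2 by auto
    then show ?thesis by (simp add: algebra_simps)
  qed
  then show "\<exists>N. \<forall>m\<ge>N. \<forall>n\<ge>N. padic_abs_rat p (X m * Y m - X n * Y n) < e" by blast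
qed

lemma padic_Cauchy_ring_cring:
  assumes p: "prime p" shows "cring (padic_Cauchy_ring p)"
proof (intro cringI abelian_groupI Group.comm_monoidI)
  fix X assume "X \<in> carrier (padic_Cauchy_ring p)"
  then show "\<exists>Y\<in>carrier (padic_Cauchy_ring p). Y \<oplus>\<^bsub>padic_Cauchy_ring p\<^esub> X = \<zero>\<^bsub>padic_Cauchy_ring p\<^esub>"
    by (intro bexI[of _ "\<lambda>n. - X n"]) (auto simp: padic_Cauchy_ring_def intro: padic_Cauchy_uminus)
qed (simp_all add: padic_Cauchy_ring_def padic_Cauchy_add[OF p] padic_Cauchy_mult[OF p]
      padic_Cauchy_const add.assoc add.commute add.left_commute mult.assoc mult.commute
      mult.left_commute distrib_left)

lemma padic_Cauchy_ring_simps: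
  "carrier (padic_Cauchy_ring p) = {X. padic_Cauchy p X}"
  "\<zero>\<^bsub>padic_Cauchy_ring p\<^esub> = (\<lambda>n. 0)" "\<one>\<^bsub>padic_Cauchy_ring p\<^esub> = (\<lambda>n. 1)"
  "X \<oplus>\<^bsub>padic_Cauchy_ring p\<^esub> Y = (\<lambda>n. X n + Y n)"
  "X \<otimes>\<^bsub>padic_Cauchy_ring p\<^esub> Y = (\<lambda>n. X n * Y n)"
  by (simp_all add: padic_Cauchy_ring_def)

lemma padic_Cauchy_ring_uminus:
  assumes p: "prime p" and X: "padic_Cauchy p X"
  shows "\<ominus>\<^bsub>padic_Cauchy_ring p\<^esub> X = (\<lambda>n. - X n)"
proof -
  interpret cring "padic_Cauchy_ring p" by (rule padic_Cauchy_ring_cring[OF p])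
  show ?thesis
    by (rule minus_equality)
       (auto simp: padic_Cauchy_ring_simps X padic_Cauchy_uminus)
qed

lemma padic_null_imp_Cauchy:
  assumes p: "prime p" and X: "X \<in> padic_null p"
  shows "padic_Cauchy p X"
  unfolding padic_Cauchy_def
proof (intro allI impI)
  fix e :: real assume e: "e > 0"
  then obtain N where N: "\<And>n. n \<ge> N \<Longrightarrow> padic_abs_rat p (X n) < e"
    using X unfolding padic_null_def LIMSEQ_def by auto
  have "padic_abs_rat p (X m - X n) < e" if "m \<ge> N" "n \<ge> N" for m n
    using padic_abs_rat_add_le_max[OF p, of "X m" "- X n"] N[OF that(1)] N[OF that(2)] by auto
  then show "\<exists>N. \<forall>m\<ge>N. \<forall>n\<ge>N. padic_abs_rat p (X m - X n) < e" by blast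
qed

lemma padic_null_add:
  assumes "prime p" "X \<in> padic_null p" "Y \<in> padic_null p"
  shows "(\<lambda>n. X n + Y n) \<in> padic_null p"
proof -
  have "(\<lambda>n. padic_abs_rat p (X n) + padic_abs_rat p (Y n)) \<longlonglongrightarrow> 0"
    using assms by (intro tendsto_add_zero) (auto simp: padic_null_def)
  then have "(\<lambda>n. padic_abs_rat p (X n + Y n)) \<longlonglongrightarrow> 0"
    by (rule Lim_null_comparison[rotated]) (simp add: padic_abs_rat_add_le[OF assms(1)])
  then show ?thesis by (simp add: padic_null_def)
qed

lemma padic_null_mult:
  assumes p: "prime p" and X: "padic_Cauchy p X" and Y: "Y \<in> padic_null p"
  shows "(\<lambda>n. X n * Y n) \<in> padic_null p"
proof -
  obtain r where "(\<lambda>n. padic_abs_rat p (X n)) \<longlonglongrightarrow> r"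
    using padic_Cauchy_abs_convergent[OF p X] by (auto simp: convergent_def)
  then have "(\<lambda>n. padic_abs_rat p (X n) * padic_abs_rat p (Y n)) \<longlonglongrightarrow> r * 0"
    using Y by (intro tendsto_mult) (auto simp: padic_null_def)
  then show ?thesis by (simp add: padic_null_def padic_abs_rat_mult[OF p])
qed

lemma padic_null_ideal:
  assumes p: "prime p" shows "ideal (padic_null p) (padic_Cauchy_ring p)"
proof -
  interpret cring "padic_Cauchy_ring p" by (rule padic_Cauchy_ring_cring[OF p])
  show ?thesis
  proof (rule idealI)
    show "subgroup (padic_null p) (add_monoid (padic_Cauchy_ring p))"
    proof (rule add.subgroupI)
      show "padic_null p \<subseteq> carrier (padic_Cauchy_ring p)"
        using padic_null_imp_Cauchy[OF p] by (auto simp: padic_Cauchy_ring_simps)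
      have "(\<lambda>n. 0) \<in> padic_null p" by (simp add: padic_null_def)
      then show "padic_null p \<noteq> {}" by blast
      fix X assume X: "X \<in> padic_null p"
      have "padic_Cauchy p X" using padic_null_imp_Cauchy[OF p X] .
      then show "\<ominus>\<^bsub>padic_Cauchy_ring p\<^esub> X \<in> padic_null p"
        using X by (simp add: padic_Cauchy_ring_uminus[OF p] padic_null_def)
      fix Y assume "Y \<in> padic_null p"
      then show "X \<oplus>\<^bsub>padic_Cauchy_ring p\<^esub> Y \<in> padic_null p"
        using X by (simp add: padic_Cauchy_ring_simps padic_null_add[OF p])
    qed
  next
    fix X Y assume XY: "X \<in> padic_null p" "Y \<in> carrier (padic_Cauchy_ring p)"
    then show "Y \<otimes>\<^bsub>padic_Cauchy_ring p\<^esub> X \<in> padic_null p"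
      by (simp add: padic_Cauchy_ring_simps padic_null_mult[OF p])
    then show "X \<otimes>\<^bsub>padic_Cauchy_ring p\<^esub> Y \<in> padic_null p"
      by (simp add: padic_Cauchy_ring_simps mult.commute)
  qed unfold_locales
qed

section \<open>The p-adic numbers as a quotient ring, and their absolute value\<close>

lemma Qp_cring: "prime p \<Longrightarrow> cring (Qp p)"
  unfolding Qp_def by (intro ideal.quotient_is_cring padic_null_ideal padic_Cauchy_ring_cring)

text \<open>Naming the coset of a representing sequence allows computations in the quotient to be
  done on sequences of rationals.\<close>

definition padic_of :: "nat \<Rightarrow> (nat \<Rightarrow> rat) \<Rightarrow> padic" where
  "padic_of p X = padic_null p +>\<^bsub>padic_Cauchy_ring p\<^esub> X"

lemma carrier_Qp: "carrier (Qp p) = padic_of p ` {X. padic_Cauchy p X}"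
  by (auto simp: Qp_def FactRing_def A_RCOSETS_def' padic_of_def padic_Cauchy_ring_simps)

lemma padic_of_closed: "padic_Cauchy p X \<Longrightarrow> padic_of p X \<in> carrier (Qp p)"
  by (simp add: carrier_Qp)

lemma mem_padic_of_iff: "Y \<in> padic_of p X \<longleftrightarrow> (\<lambda>n. Y n - X n) \<in> padic_null p"
proof
  assume "(\<lambda>n. Y n - X n) \<in> padic_null p"
  then show "Y \<in> padic_of p X"
    unfolding padic_of_def a_r_coset_def' padic_Cauchy_ring_simps
    by (intro UN_I[of "\<lambda>n. Y n - X n"]) auto
qed (auto simp: padic_of_def a_r_coset_def' padic_Cauchy_ring_simps)

lemma padic_of_add:
  assumes "prime p" "padic_Cauchy p X" "padic_Cauchy p Y"
  shows "padic_of p X \<oplus>\<^bsub>Qp p\<^esub> padic_of p Y = padic_of p (\<lambda>n. X n + Y n)"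
  using ring_hom_add[OF ideal.rcos_ring_hom[OF padic_null_ideal[OF assms(1)]], of X Y] assms
  by (simp add: Qp_def padic_of_def padic_Cauchy_ring_simps)

lemma padic_of_mult:
  assumes "prime p" "padic_Cauchy p X" "padic_Cauchy p Y"
  shows "padic_of p X \<otimes>\<^bsub>Qp p\<^esub> padic_of p Y = padic_of p (\<lambda>n. X n * Y n)"
  using ring_hom_mult[OF ideal.rcos_ring_hom[OF padic_null_ideal[OF assms(1)]], of X Y] assms
  by (simp add: Qp_def padic_of_def padic_Cauchy_ring_simps)

lemma padic_of_one: "padic_of p (\<lambda>n. 1) = \<one>\<^bsub>Qp p\<^esub>"
  by (simp add: Qp_def padic_of_def FactRing_def padic_Cauchy_ring_simps)

lemma padic_of_eq_zero:
  assumes "prime p" "X \<in> padic_null p"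
  shows "padic_of p X = \<zero>\<^bsub>Qp p\<^esub>"
proof -
  interpret ideal "padic_null p" "padic_Cauchy_ring p" by (rule padic_null_ideal[OF assms(1)])
  show ?thesis using a_rcos_const[OF assms(2)] by (simp add: Qp_def padic_of_def FactRing_def)
qed

lemma padic_of_diff:
  assumes p: "prime p" and X: "padic_Cauchy p X" and Y: "padic_Cauchy p Y"
  shows "padic_of p X \<ominus>\<^bsub>Qp p\<^esub> padic_of p Y = padic_of p (\<lambda>n. X n - Y n)"
proof -
  interpret cring "Qp p" by (rule Qp_cring[OF p])
  have "padic_of p (\<lambda>n. - Y n) \<oplus>\<^bsub>Qp p\<^esub> padic_of p Y = \<zero>\<^bsub>Qp p\<^esub>"
    using p Y by (simp add: padic_of_add padic_Cauchy_uminus padic_of_eq_zero padic_null_def)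
  then have "\<ominus>\<^bsub>Qp p\<^esub> padic_of p Y = padic_of p (\<lambda>n. - Y n)"
    using Y by (intro minus_equality) (auto intro: padic_of_closed padic_Cauchy_uminus)
  then show ?thesis
    using p X Y by (simp add: a_minus_def padic_of_add padic_Cauchy_uminus)
qed

text \<open>Two representatives differ by a null sequence, and the difference of their absolute
  values is at most the absolute value of their difference. So all representatives share one limit,
  and the description in \<open>padic_abs\<close> is well defined.\<close>

lemma padic_abs_padic_of:
  assumes p: "prime p" and lim: "(\<lambda>n. padic_abs_rat p (X n)) \<longlonglongrightarrow> r"
  shows "padic_abs p (padic_of p X) = r"
proof -
  have *: "(\<lambda>n. padic_abs_rat p (Y n)) \<longlonglongrightarrow> r" if "Y \<in> padic_of p X" for Y
  proof -
    have "(\<lambda>n. padic_abs_rat p (Y n - X n)) \<longlonglongrightarrow> 0"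
      using that by (simp add: mem_padic_of_iff padic_null_def)
    then have "(\<lambda>n. padic_abs_rat p (Y n) - padic_abs_rat p (X n)) \<longlonglongrightarrow> 0"
      by (rule Lim_null_comparison[rotated]) (simp add: padic_abs_rat_diff_bound[OF p])
    from tendsto_add[OF this lim] show ?thesis by simp
  qed
  have "X \<in> padic_of p X" by (simp add: mem_padic_of_iff padic_null_def)
  then show ?thesis
    unfolding padic_abs_def by (intro the_equality) (use * LIMSEQ_unique in blast)+
qed

lemma padic_of_cases:
  assumes p: "prime p" and x: "x \<in> carrier (Qp p)"
  obtains X where "padic_Cauchy p X" "x = padic_of p X"
    "(\<lambda>n. padic_abs_rat p (X n)) \<longlonglongrightarrow> padic_abs p x"
proof -
  obtain X where X: "padic_Cauchy p X" "x = padic_of p X" using x by (auto simp: carrier_Qp)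
  then show ?thesis
    using that padic_Cauchy_abs_convergent[OF p X(1)] padic_abs_padic_of[OF p, of X]
    by (auto simp: convergent_def)
qed

text \<open>The dichotomy for Cauchy sequences passes to classes, null sequences forming the zero
  class: completion adds no absolute values beyond the integer powers of \<open>p\<close>.\<close>

lemma padic_abs_cases:
  assumes p: "prime p" and x: "x \<in> carrier (Qp p)"
  obtains "x = \<zero>\<^bsub>Qp p\<^esub>" | k where "padic_abs p x = real p powi k"
proof -
  obtain X where X: "padic_Cauchy p X" "x = padic_of p X" using x by (auto simp: carrier_Qp)
  from padic_Cauchy_abs_tendsto[OF p X(1)] show ?thesis
    using that X(2) padic_of_eq_zero[OF p] padic_abs_padic_of[OF p] by metis
qed

lemma padic_abs_nonneg:
  assumes "prime p" "x \<in> carrier (Qp p)" shows "padic_abs p x \<ge> 0"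
  using padic_of_cases[OF assms] by (metis LIMSEQ_le_const padic_abs_rat_nonneg)

lemma padic_abs_mult:
  assumes p: "prime p" and x: "x \<in> carrier (Qp p)" and y: "y \<in> carrier (Qp p)"
  shows "padic_abs p (x \<otimes>\<^bsub>Qp p\<^esub> y) = padic_abs p x * padic_abs p y"
proof -
  obtain X where X: "padic_Cauchy p X" "x = padic_of p X"
    "(\<lambda>n. padic_abs_rat p (X n)) \<longlonglongrightarrow> padic_abs p x" using padic_of_cases[OF p x] .
  obtain Y where Y: "padic_Cauchy p Y" "y = padic_of p Y"
    "(\<lambda>n. padic_abs_rat p (Y n)) \<longlonglongrightarrow> padic_abs p y" using padic_of_cases[OF p y] .
  show ?thesis
    using padic_abs_padic_of[OF p, of "\<lambda>n. X n * Y n"] tendsto_mult[OF X(3) Y(3)]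
    by (simp add: padic_abs_rat_mult[OF p] X(2) Y(2) padic_of_mult[OF p X(1) Y(1)])
qed

lemma padic_abs_add_le_max:
  assumes p: "prime p" and x: "x \<in> carrier (Qp p)" and y: "y \<in> carrier (Qp p)"
  shows "padic_abs p (x \<oplus>\<^bsub>Qp p\<^esub> y) \<le> max (padic_abs p x) (padic_abs p y)"
proof -
  obtain X where X: "padic_Cauchy p X" "x = padic_of p X"
    "(\<lambda>n. padic_abs_rat p (X n)) \<longlonglongrightarrow> padic_abs p x" using padic_of_cases[OF p x] .
  obtain Y where Y: "padic_Cauchy p Y" "y = padic_of p Y"
    "(\<lambda>n. padic_abs_rat p (Y n)) \<longlonglongrightarrow> padic_abs p y" using padic_of_cases[OF p y] .
  have C: "padic_Cauchy p (\<lambda>n. X n + Y n)" by (rule padic_Cauchy_add[OF p X(1) Y(1)])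
  obtain r where r: "(\<lambda>n. padic_abs_rat p (X n + Y n)) \<longlonglongrightarrow> r"
    using padic_Cauchy_abs_convergent[OF p C] by (auto simp: convergent_def)
  have "r \<le> max (padic_abs p x) (padic_abs p y)"
    by (rule LIMSEQ_le[OF r tendsto_max[OF X(3) Y(3)]]) (use padic_abs_rat_add_le_max[OF p] in blast)
  then show ?thesis
    using padic_abs_padic_of[OF p r] by (simp add: X(2) Y(2) padic_of_add[OF p X(1) Y(1)])
qed

lemma padic_abs_zero: "prime p \<Longrightarrow> padic_abs p \<zero>\<^bsub>Qp p\<^esub> = 0"
  using padic_of_eq_zero[of p "\<lambda>n. 0"] padic_abs_padic_of[of p "\<lambda>n. 0" 0] by (simp add: padic_null_def)

lemma padic_abs_one: "prime p \<Longrightarrow> padic_abs p \<one>\<^bsub>Qp p\<^esub> = 1"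
  using padic_abs_padic_of[of p "\<lambda>n. 1" 1] by (simp add: padic_of_one)

lemma padic_abs_eq_0_iff:
  assumes p: "prime p" and x: "x \<in> carrier (Qp p)"
  shows "padic_abs p x = 0 \<longleftrightarrow> x = \<zero>\<^bsub>Qp p\<^esub>"
  using padic_abs_cases[OF p x] prime_gt_0_nat[OF p] padic_abs_zero[OF p]
  by (metis less_irrefl of_nat_0_less_iff zero_less_power_int)

lemma padic_abs_minus_commute:
  assumes p: "prime p" and x: "x \<in> carrier (Qp p)" and y: "y \<in> carrier (Qp p)"
  shows "padic_abs p (x \<ominus>\<^bsub>Qp p\<^esub> y) = padic_abs p (y \<ominus>\<^bsub>Qp p\<^esub> x)"
proof -
  obtain X Y where XY: "padic_Cauchy p X" "x = padic_of p X" "padic_Cauchy p Y" "y = padic_of p Y"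
    using x y by (auto simp: carrier_Qp)
  interpret cring "Qp p" by (rule Qp_cring[OF p])
  have "x \<ominus>\<^bsub>Qp p\<^esub> y \<in> carrier (Qp p)" using x y by simp
  then obtain Z where Z: "padic_Cauchy p Z" "x \<ominus>\<^bsub>Qp p\<^esub> y = padic_of p Z"
    "(\<lambda>n. padic_abs_rat p (Z n)) \<longlonglongrightarrow> padic_abs p (x \<ominus>\<^bsub>Qp p\<^esub> y)"
    using padic_of_cases[OF p] by blast
  \<comment> \<open>As a negative, the reversed difference is the class of the negated sequence,
    whose rational absolute values are unchanged.\<close>
  have "y \<ominus>\<^bsub>Qp p\<^esub> x = \<zero>\<^bsub>Qp p\<^esub> \<ominus>\<^bsub>Qp p\<^esub> (x \<ominus>\<^bsub>Qp p\<^esub> y)"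
    using x y by (simp add: a_minus_def minus_add a_comm)
  also have "\<dots> = padic_of p (\<lambda>n. - Z n)"
    using padic_of_diff[OF p padic_Cauchy_const[of p 0] Z(1)] padic_of_eq_zero[OF p, of "\<lambda>n. 0"] Z(2)
    by (simp add: padic_null_def)
  finally show ?thesis
    using padic_abs_padic_of[OF p, of "\<lambda>n. - Z n"] Z(3) by simp
qed

section \<open>The p-adic metric and the valuation shells\<close>

lemma padic_Metric_space:
  assumes p: "prime p" shows "Metric_space (carrier (Qp p)) (padic_dist p)"
proof -
  interpret cring "Qp p" by (rule Qp_cring[OF p])
  show ?thesis
  proof
    fix x y z
    show "0 \<le> padic_dist p x y"
      by (auto simp: padic_dist_def intro!: padic_abs_nonneg[OF p])
    show "padic_dist p x y = padic_dist p y x"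
      using padic_abs_minus_commute[OF p] by (auto simp: padic_dist_def)
    assume x: "x \<in> carrier (Qp p)" and y: "y \<in> carrier (Qp p)"
    have "x = (x \<ominus>\<^bsub>Qp p\<^esub> y) \<oplus>\<^bsub>Qp p\<^esub> y" using x y by algebra
    then have "x \<ominus>\<^bsub>Qp p\<^esub> y = \<zero>\<^bsub>Qp p\<^esub> \<longleftrightarrow> x = y"
      using x y by (metis a_minus_def l_zero r_neg)
    then show "padic_dist p x y = 0 \<longleftrightarrow> x = y"
      using x y by (simp add: padic_dist_def padic_abs_eq_0_iff[OF p])
    assume z: "z \<in> carrier (Qp p)"
    have "x \<ominus>\<^bsub>Qp p\<^esub> z = (x \<ominus>\<^bsub>Qp p\<^esub> y) \<oplus>\<^bsub>Qp p\<^esub> (y \<ominus>\<^bsub>Qp p\<^esub> z)"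
      using x y z by algebra
    then have "padic_abs p (x \<ominus>\<^bsub>Qp p\<^esub> z) \<le>
        max (padic_abs p (x \<ominus>\<^bsub>Qp p\<^esub> y)) (padic_abs p (y \<ominus>\<^bsub>Qp p\<^esub> z))"
      using x y z padic_abs_add_le_max[OF p, of "x \<ominus>\<^bsub>Qp p\<^esub> y" "y \<ominus>\<^bsub>Qp p\<^esub> z"] by simp
    moreover have "padic_abs p (x \<ominus>\<^bsub>Qp p\<^esub> y) \<ge> 0" "padic_abs p (y \<ominus>\<^bsub>Qp p\<^esub> z) \<ge> 0"
      using x y z by (auto intro: padic_abs_nonneg[OF p])
    ultimately show "padic_dist p x z \<le> padic_dist p x y + padic_dist p y z"
      using x y z by (simp add: padic_dist_def)
  qed
qed

text \<open>The sign makes the index the valuation, so that shell \<open>k\<close> is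
  \<open>p ^ k\<close> times the units of the p-adic integers.\<close>

definition padic_shell :: "nat \<Rightarrow> int \<Rightarrow> padic set" where
  "padic_shell p k = {x \<in> Units (Qp p). padic_abs p x = real p powi (- k)}"

lemma padic_shell_disjoint:
  assumes "prime p" "j \<noteq> k" shows "padic_shell p j \<inter> padic_shell p k = {}"
proof -
  have "real p > 1" using prime_gt_1_nat[OF assms(1)] by simp
  then have "real p powi (- j) \<noteq> real p powi (- k)"
    using power_int_strict_increasing[of "- j" "- k" "real p"]
      power_int_strict_increasing[of "- k" "- j" "real p"] assms(2) by (cases "j < k") auto
  then show ?thesis by (auto simp: padic_shell_def)
qed

lemma padic_abs_Units_pos:
  assumes p: "prime p" and x: "x \<in> Units (Qp p)" shows "padic_abs p x > 0"
proof -
  obtain y where y: "y \<in> carrier (Qp p)" "x \<otimes>\<^bsub>Qp p\<^esub> y = \<one>\<^bsub>Qp p\<^esub>" "x \<in> carrier (Qp p)"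
    using x by (auto simp: Units_def)
  then have "padic_abs p x * padic_abs p y = 1"
    using padic_abs_mult[OF p, of x y] padic_abs_one[OF p] by simp
  then have "padic_abs p x \<noteq> 0" by auto
  then show ?thesis using padic_abs_nonneg[OF p y(3)] by simp
qed

lemma padic_shell_cover:
  assumes p: "prime p" shows "(\<Union>k. padic_shell p k) = Units (Qp p)"
proof -
  have "\<exists>k. padic_abs p x = real p powi (- k)" if x: "x \<in> Units (Qp p)" for x
  proof -
    have "x \<in> carrier (Qp p)" using x by (simp add: Units_def)
    then show ?thesis
      using padic_abs_cases[OF p, of x] padic_abs_Units_pos[OF p x] padic_abs_zero[OF p]
      by (metis less_irrefl minus_minus)
  qed
  then show ?thesis by (auto simp: padic_shell_def)
qed

text \<open>A unit and its inverse both have absolute value at most \<open>1\<close> and their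
  product has absolute value \<open>1\<close>, which forces equality. Conversely, if
  \<open>x\<close> is invertible in \<open>Qp p\<close> with absolute value \<open>1\<close>, then
  so is its inverse, which therefore lies in \<open>Zp p\<close>.\<close>

lemma Units_Zp:
  assumes p: "prime p" shows "Units (Zp p) = padic_shell p 0"
proof -
  interpret cring "Qp p" by (rule Qp_cring[OF p])
  have abs: "padic_abs p x * padic_abs p y = 1"
    if "x \<in> carrier (Qp p)" "y \<in> carrier (Qp p)" "x \<otimes>\<^bsub>Qp p\<^esub> y = \<one>\<^bsub>Qp p\<^esub>" for x y
    using padic_abs_mult[OF p that(1,2)] padic_abs_one[OF p] that(3) by simp
  have eq: "padic_abs p x = 1"
    if "x \<in> carrier (Qp p)" "y \<in> carrier (Qp p)" "x \<otimes>\<^bsub>Qp p\<^esub> y = \<one>\<^bsub>Qp p\<^esub>"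
      "padic_abs p x \<le> 1" "padic_abs p y \<le> 1" for x y
  proof -
    have "1 \<le> padic_abs p x * 1"
      using abs[OF that(1-3)] mult_left_mono[OF that(5) padic_abs_nonneg[OF p that(1)]] by simp
    then show ?thesis using that(4) by simp
  qed
  show ?thesis
  proof (intro Set.set_eqI iffI)
    fix x assume "x \<in> Units (Zp p)"
    then show "x \<in> padic_shell p 0"
      by (auto simp: Units_def Zp_def padic_shell_def m_comm intro: eq)
  next
    fix x assume "x \<in> padic_shell p 0"
    then show "x \<in> Units (Zp p)"
      using abs by (force simp: Units_def Zp_def padic_shell_def)
  qed
qed

text \<open>Constant sequences supply explicit elements of the shells: powers of \<open>p\<close>
  for the Haar measure computation, and positive integers \<open>n\<close> for the ideles.\<close>

lemma padic_of_rat_in_shell: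
  assumes p: "prime p" and q: "q \<noteq> 0"
  shows "padic_of p (\<lambda>n. q) \<in> padic_shell p (padic_val p q)"
proof -
  have "padic_of p (\<lambda>n. q) \<in> Units (Qp p)"
    unfolding Units_def
    using q by (auto simp: padic_of_closed padic_Cauchy_const padic_of_mult[OF p] padic_of_one
        intro!: bexI[of _ "padic_of p (\<lambda>n. inverse q)"])
  moreover have "padic_abs p (padic_of p (\<lambda>n. q)) = padic_abs_rat p q"
    by (rule padic_abs_padic_of[OF p tendsto_const])
  ultimately show ?thesis using q by (simp add: padic_shell_def padic_abs_rat_def)
qed

text \<open>Absolute values multiply, so \<open>g\<close> shifts valuations by \<open>j\<close>; its
  inverse shifts them back, which makes the image the whole shell.\<close>

lemma padic_shell_translate:
  assumes p: "prime p" and g: "g \<in> padic_shell p j"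
  shows "(\<lambda>x. g \<otimes>\<^bsub>Qp p\<^esub> x) ` padic_shell p k = padic_shell p (j + k)"
proof -
  interpret cring "Qp p" by (rule Qp_cring[OF p])
  have p0: "real p \<noteq> 0" using p by auto
  have gU: "g \<in> Units (Qp p)" and ga: "padic_abs p g = real p powi (- j)"
    using g by (auto simp: padic_shell_def)
  let ?h = "inv\<^bsub>Qp p\<^esub> g"
  have h: "?h \<in> Units (Qp p)" using gU by simp
  have "padic_abs p g * padic_abs p ?h = 1"
    using padic_abs_mult[OF p, of g ?h] gU padic_abs_one[OF p] by (simp add: Units_closed)
  then have ha: "padic_abs p ?h = real p powi j"
    unfolding ga using p0 by (simp add: power_int_minus field_simps)
  show ?thesis
  proof (intro Set.set_eqI iffI)
    fix y assume "y \<in> (\<lambda>x. g \<otimes>\<^bsub>Qp p\<^esub> x) ` padic_shell p k"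
    then show "y \<in> padic_shell p (j + k)"
      using gU ga p0 power_int_add[of "real p" "- j" "- k"]
      by (auto simp: padic_shell_def padic_abs_mult[OF p] Units_closed)
  next
    fix y assume y: "y \<in> padic_shell p (j + k)"
    have "?h \<otimes>\<^bsub>Qp p\<^esub> y \<in> padic_shell p k"
      using y h ha p0 power_int_add[of "real p" j "- (j + k)"]
      by (auto simp: padic_shell_def padic_abs_mult[OF p] Units_closed)
    moreover have "g \<otimes>\<^bsub>Qp p\<^esub> (?h \<otimes>\<^bsub>Qp p\<^esub> y) = y"
      using gU h y by (simp add: m_assoc[symmetric] Units_closed padic_shell_def)
    ultimately show "y \<in> (\<lambda>x. g \<otimes>\<^bsub>Qp p\<^esub> x) ` padic_shell p k" by (metis image_eqI)
  qed
qed

lemma padic_abs_isosceles: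
  assumes p: "prime p" and x: "x \<in> carrier (Qp p)" and y: "y \<in> carrier (Qp p)"
    and less: "padic_abs p (x \<ominus>\<^bsub>Qp p\<^esub> y) < padic_abs p x"
  shows "padic_abs p y = padic_abs p x"
proof -
  interpret cring "Qp p" by (rule Qp_cring[OF p])
  have "x = (x \<ominus>\<^bsub>Qp p\<^esub> y) \<oplus>\<^bsub>Qp p\<^esub> y" "y = (y \<ominus>\<^bsub>Qp p\<^esub> x) \<oplus>\<^bsub>Qp p\<^esub> x"
    using x y by algebra+
  then have "padic_abs p x \<le> max (padic_abs p (x \<ominus>\<^bsub>Qp p\<^esub> y)) (padic_abs p y)"
    "padic_abs p y \<le> max (padic_abs p (x \<ominus>\<^bsub>Qp p\<^esub> y)) (padic_abs p x)"
    using padic_abs_add_le_max[OF p, of "x \<ominus>\<^bsub>Qp p\<^esub> y" y]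
      padic_abs_add_le_max[OF p, of "y \<ominus>\<^bsub>Qp p\<^esub> x" x] x y
    by (simp_all add: padic_abs_minus_commute[OF p y x])
  then show ?thesis using less by linarith
qed

lemma openin_padic_shell:
  assumes p: "prime p" shows "openin (Qp_units_topology p) (padic_shell p k)"
proof -
  interpret Metric_space "carrier (Qp p)" "padic_dist p" by (rule padic_Metric_space[OF p])
  let ?T = "{x \<in> carrier (Qp p). padic_abs p x = real p powi (- k)}"
  have "openin mtopology ?T"
    unfolding openin_mtopology
  proof (intro conjI allI impI)
    fix x assume x: "x \<in> ?T"
    \<comment> \<open>The isosceles property allows the radius \<open>padic_abs p x\<close> itself:
      any point closer to \<open>x\<close> than that has the same absolute value.\<close>
    have "mball x (padic_abs p x) \<subseteq> ?T"
    proof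
      fix y assume "y \<in> mball x (padic_abs p x)"
      then have "y \<in> carrier (Qp p)" "padic_abs p (x \<ominus>\<^bsub>Qp p\<^esub> y) < padic_abs p x"
        by (auto simp: in_mball padic_dist_def)
      then show "y \<in> ?T" using padic_abs_isosceles[OF p, of x y] x by auto
    qed
    moreover have "padic_abs p x > 0" using x prime_gt_0_nat[OF p] by simp
    ultimately show "\<exists>r>0. mball x r \<subseteq> ?T" by blast
  qed auto
  moreover have "padic_shell p k = ?T \<inter> Units (Qp p)"
    by (auto simp: padic_shell_def Units_def)
  ultimately show ?thesis
    unfolding Qp_units_topology_def openin_subtopology by blast
qed

lemma topspace_Qp_units:
  assumes p: "prime p" shows "topspace (Qp_units_topology p) = Units (Qp p)"
proof -
  interpret Metric_space "carrier (Qp p)" "padic_dist p" by (rule padic_Metric_space[OF p])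
  show ?thesis by (auto simp: Qp_units_topology_def Units_def)
qed

section \<open>Haar measure of the shells\<close>

context
  fixes p :: nat and N :: "padic measure"
  assumes p: "prime p" and haar: "is_haar_measure (units_of (Qp p)) (Qp_units_topology p) N"
begin

lemma space_haar_Qp: "space N = Units (Qp p)"
  using haar topspace_Qp_units[OF p] by (simp add: is_haar_measure_def)

lemma sets_haar_padic_shell: "padic_shell p k \<in> sets N"
  using haar openin_padic_shell[OF p] by (auto simp: is_haar_measure_def intro: sigma_sets.Basic)

text \<open>Multiplication by \<open>p\<close> to the power \<open>k\<close> carries the units of
  the p-adic integers onto shell \<open>k\<close>, so invariance gives all shells the same
  mass.\<close>

lemma emeasure_haar_padic_shell: "emeasure N (padic_shell p k) = emeasure N (Units (Zp p))"
proof -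
  let ?g = "padic_of p (\<lambda>n. of_nat p powi k)"
  have val: "padic_val p (of_nat p ^ n) = int n" for n
    using padic_val_fraction[OF p, of "int p ^ n" 1] p
    by (simp add: multiplicity_same_power)
  have "padic_val p (of_nat p powi k) = k"
  proof (cases "k \<ge> 0")
    case True
    then show ?thesis using val[of "nat k"] by (simp add: power_int_def)
  next
    case False
    \<comment> \<open>A negative power is rewritten as a fraction with numerator \<open>1\<close>,
      the form from which \<open>padic_val_fraction\<close> reads off valuations.\<close>
    have "padic_val p (of_int 1 / of_int (int p ^ nat (- k))) = - int (nat (- k))"
      using padic_val_fraction[OF p, of 1 "int p ^ nat (- k)"] p
      by (simp add: multiplicity_same_power)
    then show ?thesis using False by (simp add: power_int_def field_simps)
  qed
  then have g: "?g \<in> padic_shell p k"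
    using padic_of_rat_in_shell[OF p, of "of_nat p powi k"] p by auto
  then have "?g \<in> carrier (units_of (Qp p))" by (simp add: padic_shell_def units_of_carrier)
  then have "emeasure N ((\<lambda>x. ?g \<otimes>\<^bsub>Qp p\<^esub> x) ` padic_shell p 0) = emeasure N (padic_shell p 0)"
    using haar sets_haar_padic_shell[of 0] unfolding is_haar_measure_def units_of_mult by blast
  then show ?thesis using padic_shell_translate[OF p g, of 0] by (simp add: Units_Zp[OF p])
qed

end

subsection \<open>Restricted product measures\<close>

text \<open>The set \<open>S i 0\<close> is the factor taken by almost all coordinates.\<close>

locale restricted_product =
  fixes I :: "'i set" and \<nu> :: "'i \<Rightarrow> 'a measure" and S :: "'i \<Rightarrow> int \<Rightarrow> 'a set"
  assumes countable_I: "countable I"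
    and sets_S: "i \<in> I \<Longrightarrow> S i k \<in> sets (\<nu> i)"
    and disjoint_S: "i \<in> I \<Longrightarrow> j \<noteq> k \<Longrightarrow> S i j \<inter> S i k = {}"
    and cover_S: "i \<in> I \<Longrightarrow> (\<Union>k. S i k) = space (\<nu> i)"
    and emeasure_S: "i \<in> I \<Longrightarrow> emeasure (\<nu> i) (S i k) = 1"
begin

text \<open>Vectors vanish outside \<open>I\<close> so that different vectors have disjoint cells;
  sums over \<open>exponents\<close> then count each cell once.\<close>

definition exponents :: "('i \<Rightarrow> int) set" where
  "exponents = {k. finite {i. k i \<noteq> 0} \<and> {i. k i \<noteq> 0} \<subseteq> I}"

definition points :: "('i \<Rightarrow> 'a) set" where
  "points = {x \<in> \<Pi>\<^sub>E i\<in>I. space (\<nu> i). finite {i \<in> I. x i \<notin> S i 0}}"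

definition boxes :: "('i \<Rightarrow> 'a set) set" where
  "boxes = {U. (\<forall>i\<in>I. U i \<in> sets (\<nu> i)) \<and> finite {i \<in> I. U i \<noteq> S i 0}}"

text \<open>Same shape as \<open>fin_idele_measure\<close>, with \<open>I\<close> and
  \<open>S i 0\<close> in place of the primes and the units of the p-adic integers.\<close>

definition box_measure :: "('i \<Rightarrow> 'a) measure" where
  "box_measure = extend_measure points boxes (\<lambda>U. \<Pi>\<^sub>E i\<in>I. U i)
     (\<lambda>U. \<Prod>i | i \<in> I \<and> U i \<noteq> S i 0. emeasure (\<nu> i) (U i))"

text \<open>Each \<open>S i (k i)\<close> with \<open>i\<close> in \<open>I\<close> has mass
  \<open>1\<close>, so conditioning on it rescales nothing and yields a probability measure, as the
  infinite product demands. The result lives on the full product space but is concentrated on the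
  cell of \<open>k\<close>.\<close>

definition cell_measure :: "('i \<Rightarrow> int) \<Rightarrow> ('i \<Rightarrow> 'a) measure" where
  "cell_measure k = (\<Pi>\<^sub>M i\<in>I. uniform_measure (\<nu> i) (S i (k i)))"

lemma countable_exponents: "countable exponents"
proof -
  \<comment> \<open>\<open>?c\<close> extends a function on a finite support by \<open>0\<close>.
    There are countably many finite supports in \<open>I\<close>, and countably many integer
    functions on each.\<close>
  let ?c = "\<lambda>F g i. if i \<in> F then g i else (0::int)"
  have "exponents \<subseteq> (\<Union>F\<in>{F. finite F \<and> F \<subseteq> I}. ?c F ` (\<Pi>\<^sub>E i\<in>F. UNIV))"
  proof
    fix k assume k: "k \<in> exponents"
    have "k = ?c {i. k i \<noteq> 0} (restrict k {i. k i \<noteq> 0})" by (auto simp: fun_eq_iff)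
    moreover have "restrict k {i. k i \<noteq> 0} \<in> (\<Pi>\<^sub>E i\<in>{i. k i \<noteq> 0}. UNIV)" by auto
    ultimately show "k \<in> (\<Union>F\<in>{F. finite F \<and> F \<subseteq> I}. ?c F ` (\<Pi>\<^sub>E i\<in>F. UNIV))"
      using k unfolding exponents_def by blast
  qed
  moreover have "countable (\<Union>F\<in>{F. finite F \<and> F \<subseteq> I}. ?c F ` (\<Pi>\<^sub>E i\<in>F. UNIV))"
    using countable_Collect_finite_subset[OF countable_I]
    by (intro countable_UN countable_image countable_PiE) auto
  ultimately show ?thesis by (rule countable_subset)
qed

lemma cell_in_boxes: "k \<in> exponents \<Longrightarrow> (\<lambda>i. S i (k i)) \<in> boxes"
  unfolding boxes_def exponents_def
  by (auto simp: sets_S intro: rev_finite_subset[of "{i. k i \<noteq> 0}"])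

lemma PiE_box_subset: "U \<in> boxes \<Longrightarrow> (\<Pi>\<^sub>E i\<in>I. U i) \<subseteq> points"
proof
  fix x assume U: "U \<in> boxes" and x: "x \<in> (\<Pi>\<^sub>E i\<in>I. U i)"
  have "{i \<in> I. x i \<notin> S i 0} \<subseteq> {i \<in> I. U i \<noteq> S i 0}" using x by (auto simp: PiE_iff)
  then have "finite {i \<in> I. x i \<notin> S i 0}" using U by (auto simp: boxes_def intro: finite_subset)
  moreover have "U i \<subseteq> space (\<nu> i)" if "i \<in> I" for i
    using U that by (auto simp: boxes_def dest: sets.sets_into_space)
  ultimately show "x \<in> points" using x unfolding points_def PiE_iff by blast
qed

lemma points_eq_cells: "points = (\<Union>k\<in>exponents. \<Pi>\<^sub>E i\<in>I. S i (k i))"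
proof
  show "(\<Union>k\<in>exponents. \<Pi>\<^sub>E i\<in>I. S i (k i)) \<subseteq> points"
    using PiE_box_subset[OF cell_in_boxes] by blast
  show "points \<subseteq> (\<Union>k\<in>exponents. \<Pi>\<^sub>E i\<in>I. S i (k i))"
  proof
    fix x assume x: "x \<in> points"
    have "\<exists>j. x i \<in> S i j" if "i \<in> I" for i
      using x that cover_S[OF that] by (auto simp: points_def PiE_iff)
    then obtain j where j: "\<And>i. i \<in> I \<Longrightarrow> x i \<in> S i (j i)" by metis
    define k where "k = (\<lambda>i. if i \<in> I then j i else 0)"
    \<comment> \<open>By disjointness a nonzero exponent keeps \<open>x i\<close> out of
      \<open>S i 0\<close>, so the support lies in the finite exceptional set of
      \<open>x\<close>.\<close>
    have "{i. k i \<noteq> 0} \<subseteq> {i \<in> I. x i \<notin> S i 0}"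
    proof
      fix i assume "i \<in> {i. k i \<noteq> 0}"
      then have "i \<in> I" "j i \<noteq> 0" by (auto simp: k_def split: if_splits)
      then show "i \<in> {i \<in> I. x i \<notin> S i 0}" using j[of i] disjoint_S[of i "j i" 0] by auto
    qed
    then have "k \<in> exponents"
      using x unfolding exponents_def points_def by (auto intro: finite_subset)
    moreover have "x \<in> (\<Pi>\<^sub>E i\<in>I. S i (k i))"
      using x j by (auto simp: points_def k_def PiE_iff)
    ultimately show "x \<in> (\<Union>k\<in>exponents. \<Pi>\<^sub>E i\<in>I. S i (k i))" by blast
  qed
qed

section \<open>Product probability measures on the cells\<close>

lemma sets_cell_measure: "sets (cell_measure k) = sets (\<Pi>\<^sub>M i\<in>I. \<nu> i)"
  unfolding cell_measure_def by (intro sets_PiM_cong) auto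

lemma PiE_box_measurable: "U \<in> boxes \<Longrightarrow> (\<Pi>\<^sub>E i\<in>I. U i) \<in> sets (cell_measure k)"
  unfolding sets_cell_measure by (intro sets_PiM_I_countable countable_I) (auto simp: boxes_def)

text \<open>Complements are taken in \<open>points\<close>, so \<open>points\<close> must itself be
  measurable in the full product; it is a countable union of cells. Hence every
  \<open>cell_measure k\<close> is countably additive on the sets generated by boxes.\<close>

lemma sigma_boxes_subset:
  "sigma_sets points ((\<lambda>U. \<Pi>\<^sub>E i\<in>I. U i) ` boxes) \<subseteq> sets (cell_measure k)"
proof
  have pts: "points \<in> sets (cell_measure k)"
    unfolding points_eq_cells
    by (intro sets.countable_UN' countable_exponents) (auto intro: PiE_box_measurable cell_in_boxes)
  fix A assume "A \<in> sigma_sets points ((\<lambda>U. \<Pi>\<^sub>E i\<in>I. U i) ` boxes)"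
  then show "A \<in> sets (cell_measure k)"
    by induction (use pts PiE_box_measurable in auto)
qed

lemma prob_space_cell: "i \<in> I \<Longrightarrow> prob_space (uniform_measure (\<nu> i) (S i (k i)))"
  by (rule prob_space_uniform_measure) (auto simp: emeasure_S)

lemma AE_cell: "AE x in cell_measure k. \<forall>i\<in>I. x i \<in> S i (k i)"
  unfolding AE_ball_countable[OF countable_I] cell_measure_def
  by (intro ballI AE_PiM_component prob_space_cell AE_uniform_measureI sets_S) auto

text \<open>Outside the finite set \<open>F\<close> the box asks for \<open>S i 0\<close> and the
  cell for \<open>S i (k i)\<close>. If these disagree anywhere, cell and box are disjoint; if they
  agree throughout, the box is almost everywhere a cylinder over \<open>F\<close>, whose measure is
  a finite product.\<close>

lemma emeasure_cell_box:
  assumes U: "U \<in> boxes"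
  defines "F \<equiv> {i \<in> I. U i \<noteq> S i 0}"
  shows "emeasure (cell_measure k) (\<Pi>\<^sub>E i\<in>I. U i) =
    (if \<forall>i\<in>I - F. k i = 0 then \<Prod>i\<in>F. emeasure (\<nu> i) (S i (k i) \<inter> U i) else 0)"
proof (cases "\<forall>i\<in>I - F. k i = 0")
  case True
  let ?M = "\<lambda>i. uniform_measure (\<nu> i) (S i (k i))"
  have F: "finite F" "F \<subseteq> I" using U by (auto simp: F_def boxes_def)
  have UF: "\<And>i. i \<in> F \<Longrightarrow> U i \<in> sets (\<nu> i)" using U by (auto simp: F_def boxes_def)
  have emb: "prod_emb I ?M F (Pi\<^sub>E F U) \<in> sets (cell_measure k)"
    unfolding cell_measure_def using F UF by (intro sets_PiM_I) auto
  \<comment> \<open>Coordinates outside \<open>F\<close> satisfy the box condition almost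
    everywhere, because there \<open>U i\<close> is \<open>S i 0\<close> and \<open>k i\<close> is
    \<open>0\<close>.\<close>
  have "AE x in cell_measure k. x \<in> (\<Pi>\<^sub>E i\<in>I. U i) \<longleftrightarrow> x \<in> prod_emb I ?M F (Pi\<^sub>E F U)"
    using AE_cell[of k]
  proof (rule AE_mp[OF _ AE_I2], intro impI)
    fix x assume x: "x \<in> space (cell_measure k)" "\<forall>i\<in>I. x i \<in> S i (k i)"
    have xI: "x \<in> extensional I" "\<forall>i\<in>I. x i \<in> space (\<nu> i)"
      using x(1) by (auto simp: cell_measure_def space_PiM PiE_iff)
    have "\<forall>i\<in>I - F. x i \<in> U i" using x(2) True by (auto simp: F_def)
    then show "x \<in> (\<Pi>\<^sub>E i\<in>I. U i) \<longleftrightarrow> x \<in> prod_emb I ?M F (Pi\<^sub>E F U)"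
      using xI F(2) by (auto simp: prod_emb_def PiE_iff)
  qed
  then have "emeasure (cell_measure k) (\<Pi>\<^sub>E i\<in>I. U i) =
      emeasure (cell_measure k) (prod_emb I ?M F (Pi\<^sub>E F U))"
    using emb PiE_box_measurable[OF U] by (intro emeasure_eq_AE)
  also have "\<dots> = (\<Prod>i\<in>F. emeasure (?M i) (U i))"
    unfolding cell_measure_def using F UF by (intro emeasure_PiM_emb prob_space_cell) auto
  also have "\<dots> = (\<Prod>i\<in>F. emeasure (\<nu> i) (S i (k i) \<inter> U i))"
    using F(2) UF
    by (intro prod.cong refl, subst emeasure_uniform_measure) (auto simp: emeasure_S[OF subsetD] sets_S
        divide_ennreal_def)
  finally show ?thesis using True by simp
next
  case False
  then obtain i where i: "i \<in> I" "U i = S i 0" "k i \<noteq> 0" by (auto simp: F_def)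
  have "AE x in cell_measure k. x \<notin> (\<Pi>\<^sub>E i\<in>I. U i)"
    using AE_cell[of k]
  proof (rule AE_mp[OF _ AE_I2], intro impI notI)
    fix x assume "\<forall>i\<in>I. x i \<in> S i (k i)" "x \<in> (\<Pi>\<^sub>E i\<in>I. U i)"
    then have "x i \<in> S i (k i) \<inter> S i 0" using i by (auto simp: PiE_iff)
    then show False using disjoint_S[OF i(1,3)] by blast
  qed
  then have "emeasure (cell_measure k) (\<Pi>\<^sub>E i\<in>I. U i) = 0"
    using PiE_box_measurable[OF U]
    by (subst (asm) AE_iff_measurable[OF PiE_box_measurable[OF U, of k]])
      (auto dest: sets.sets_into_space)
  then show ?thesis unfolding if_not_P[OF False] .
qed

text \<open>Only exponents supported in \<open>F\<close> contribute. The sum over them of products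
  over \<open>F\<close> factors into a product of sums over single exponents, and each such sum
  gives the measure of \<open>U i\<close> because the sets \<open>S i j\<close> partition the
  space.\<close>

lemma nn_integral_emeasure_cell_box:
  assumes U: "U \<in> boxes"
  shows "(\<integral>\<^sup>+k. emeasure (cell_measure k) (\<Pi>\<^sub>E i\<in>I. U i) \<partial>count_space exponents) =
    (\<Prod>i | i \<in> I \<and> U i \<noteq> S i 0. emeasure (\<nu> i) (U i))"
proof -
  define F where "F = {i \<in> I. U i \<noteq> S i 0}"
  have F: "finite F" "F \<subseteq> I" using U by (auto simp: F_def boxes_def)
  define E where "E = {k :: 'i \<Rightarrow> int. \<forall>i. i \<notin> F \<longrightarrow> k i = 0}"
  let ?c = "\<lambda>g i. if i \<in> F then g i else (0::int)"
  let ?f = "\<lambda>i j. emeasure (\<nu> i) (S i j \<inter> U i)"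
  have sub: "E \<subseteq> exponents"
    using F by (auto simp: E_def exponents_def intro: rev_finite_subset[of F])
  have E_iff: "k \<in> E \<longleftrightarrow> (\<forall>i\<in>I - F. k i = 0)" if "k \<in> exponents" for k
    using that by (auto simp: E_def exponents_def)
  \<comment> \<open>Restriction to \<open>F\<close> identifies \<open>E\<close> with the integer
    functions on \<open>F\<close>, the index set of a finite product of counting measures.\<close>
  have bij: "bij_betw ?c (\<Pi>\<^sub>E i\<in>F. UNIV) E"
  proof (rule bij_betwI[where g = "\<lambda>k. restrict k F"])
    show "restrict (?c g) F = g" if "g \<in> (\<Pi>\<^sub>E i\<in>F. UNIV)" for g
      using that by (auto simp: fun_eq_iff PiE_iff extensional_def)
    show "?c (restrict k F) = k" if "k \<in> E" for k
      using that by (auto simp: fun_eq_iff E_def)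
  qed (auto simp: E_def)
  \<comment> \<open>Fubini for counting measures on the integers turns the sum of products into a
    product of sums.\<close>
  interpret product_sigma_finite "\<lambda>_::'i. count_space (UNIV :: int set)"
    by (simp add: product_sigma_finite_def sigma_finite_measure_count_space)
  have "(\<integral>\<^sup>+k. emeasure (cell_measure k) (\<Pi>\<^sub>E i\<in>I. U i) \<partial>count_space exponents) =
      (\<integral>\<^sup>+k. emeasure (cell_measure k) (\<Pi>\<^sub>E i\<in>I. U i) \<partial>count_space E)"
    using sub by (intro nn_integral_count_space_eq)
      (auto simp: emeasure_cell_box[OF U] E_iff simp flip: F_def)
  also have "\<dots> = (\<integral>\<^sup>+k. (\<Prod>i\<in>F. ?f i (k i)) \<partial>count_space E)"
    using sub E_iff
    by (intro nn_integral_cong) (auto simp: emeasure_cell_box[OF U] simp flip: F_def)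
  also have "\<dots> = (\<integral>\<^sup>+g. (\<Prod>i\<in>F. ?f i (?c g i)) \<partial>count_space (\<Pi>\<^sub>E i\<in>F. UNIV))"
    by (rule nn_integral_bij_count_space[OF bij, symmetric])
  also have "\<dots> = (\<integral>\<^sup>+g. (\<Prod>i\<in>F. ?f i (g i)) \<partial>count_space (\<Pi>\<^sub>E i\<in>F. UNIV))"
    by (intro nn_integral_cong prod.cong) auto
  also have "\<dots> = (\<integral>\<^sup>+g. (\<Prod>i\<in>F. ?f i (g i)) \<partial>(\<Pi>\<^sub>M i\<in>F. count_space UNIV))"
    using F(1) by (subst count_space_PiM_finite) auto
  also have "\<dots> = (\<Prod>i\<in>F. \<integral>\<^sup>+j. ?f i j \<partial>count_space UNIV)"
    using F(1) by (intro product_nn_integral_prod) auto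
  also have "\<dots> = (\<Prod>i\<in>F. emeasure (\<nu> i) (U i))"
  proof (rule prod.cong[OF refl])
    fix i assume "i \<in> F"
    then have i: "i \<in> I" "U i \<in> sets (\<nu> i)" using U by (auto simp: F_def boxes_def)
    have "(\<integral>\<^sup>+j. ?f i j \<partial>count_space UNIV) = emeasure (\<nu> i) (\<Union>j. S i j \<inter> U i)"
      using i disjoint_S[OF i(1)]
      by (intro emeasure_UN_countable[symmetric]) (auto simp: sets_S disjoint_family_on_def)
    also have "(\<Union>j. S i j \<inter> U i) = U i"
      using cover_S[OF i(1)] sets.sets_into_space[OF i(2)] by blast
    finally show "(\<integral>\<^sup>+j. ?f i j \<partial>count_space UNIV) = emeasure (\<nu> i) (U i)" .
  qed
  finally show ?thesis by (simp add: F_def)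
qed

section \<open>The measure generated by the boxes\<close>

lemma space_box_measure: "space box_measure = points"
  unfolding box_measure_def by (rule space_extend_measure) (use PiE_box_subset in auto)

lemma sets_box_measure:
  "sets box_measure = sigma_sets points ((\<lambda>U. \<Pi>\<^sub>E i\<in>I. U i) ` boxes)"
  unfolding box_measure_def by (rule sets_extend_measure) (use PiE_box_subset in auto)

lemma sets_box: "U \<in> boxes \<Longrightarrow> (\<Pi>\<^sub>E i\<in>I. U i) \<in> sets box_measure"
  by (auto simp: sets_box_measure)

lemma emeasure_box_measure:
  assumes U: "U \<in> boxes"
  shows "emeasure box_measure (\<Pi>\<^sub>E i\<in>I. U i) =
    (\<Prod>i | i \<in> I \<and> U i \<noteq> S i 0. emeasure (\<nu> i) (U i))"
proof (rule emeasure_extend_measure[OF box_measure_def _ _ _ _ U])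
  \<comment> \<open>\<open>extend_measure\<close> takes the prescribed values only if some measure
    does. The witness is the sum of all cell measures.\<close>
  let ?m = "\<lambda>A. \<integral>\<^sup>+k. emeasure (cell_measure k) A \<partial>count_space exponents"
  show "?m (\<Pi>\<^sub>E i\<in>I. V i) = (\<Prod>i | i \<in> I \<and> V i \<noteq> S i 0. emeasure (\<nu> i) (V i))" if "V \<in> boxes" for V
    by (rule nn_integral_emeasure_cell_box[OF that])
  show "(\<lambda>U. \<Pi>\<^sub>E i\<in>I. U i) ` boxes \<subseteq> Pow points" using PiE_box_subset by auto
  show "positive (sets box_measure) ?m" by (simp add: positive_def)
  show "countably_additive (sets box_measure) ?m"
  proof (rule countably_additiveI)
    fix A :: "nat \<Rightarrow> ('i \<Rightarrow> 'a) set"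
    assume A: "range A \<subseteq> sets box_measure" "disjoint_family A"
    \<comment> \<open>Summation over the sets and over the cells may be exchanged since all terms
      are nonnegative.\<close>
    have "(\<Sum>n. ?m (A n)) = (\<integral>\<^sup>+k. (\<Sum>n. emeasure (cell_measure k) (A n)) \<partial>count_space exponents)"
      by (rule nn_integral_suminf[symmetric]) simp
    also have "\<dots> = ?m (\<Union>n. A n)"
    proof (rule nn_integral_cong)
      fix k
      have "range A \<subseteq> sets (cell_measure k)"
        using A(1) sigma_boxes_subset[of k] by (auto simp: sets_box_measure)
      then show "(\<Sum>n. emeasure (cell_measure k) (A n)) = emeasure (cell_measure k) (\<Union>n. A n)"
        using A(2) by (rule suminf_emeasure)
    qed
    finally show "(\<Sum>n. ?m (A n)) = ?m (\<Union>n. A n)" .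
  qed
qed

lemma emeasure_cell: "k \<in> exponents \<Longrightarrow> emeasure box_measure (\<Pi>\<^sub>E i\<in>I. S i (k i)) = 1"
  by (simp add: emeasure_box_measure[OF cell_in_boxes] emeasure_S)

text \<open>Countably many cells of measure \<open>1\<close> exhaust the space. This makes the
  product of two copies of the measure behave on rectangles.\<close>

lemma sigma_finite_box_measure: "sigma_finite_measure box_measure"
proof
  let ?A = "(\<lambda>k. \<Pi>\<^sub>E i\<in>I. S i (k i)) ` exponents"
  have "countable ?A" "?A \<subseteq> sets box_measure" "\<Union>?A = space box_measure"
    "\<forall>a\<in>?A. emeasure box_measure a \<noteq> \<infinity>"
    using countable_exponents sets_box[OF cell_in_boxes]
    by (auto simp: emeasure_cell space_box_measure points_eq_cells)
  then show "\<exists>A. countable A \<and> A \<subseteq> sets box_measure \<and> \<Union>A = space box_measure \<and>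
      (\<forall>a\<in>A. emeasure box_measure a \<noteq> \<infinity>)" by blast
qed

end

subsection \<open>The finite ideles\<close>

lemma padic_val_of_nat:
  assumes "prime p" "n > 0" shows "padic_val p (of_nat n) = int (multiplicity p n)"
proof -
  have "multiplicity (int p) (int n) = multiplicity p n"
    by (simp add: multiplicity_def flip: of_nat_power)
  then show ?thesis using padic_val_fraction[OF assms(1), of "int n" 1] assms(2) by simp
qed

text \<open>Turns the n-fold sum in \<open>nat_Zhat_units\<close> into multiplication by a p-adic
  number, to which shell translation applies.\<close>

lemma Qp_add_pow_eq:
  assumes p: "prime p" and x: "x \<in> carrier (Qp p)"
  shows "[n] \<cdot>\<^bsub>Qp p\<^esub> x = padic_of p (\<lambda>_. of_nat n) \<otimes>\<^bsub>Qp p\<^esub> x"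
proof -
  interpret cring "Qp p" by (rule Qp_cring[OF p])
  show ?thesis
  proof (induction n)
    case 0
    then show ?case using x padic_of_eq_zero[OF p, of "\<lambda>n. 0"] by (simp add: padic_null_def)
  next
    case (Suc n)
    have "padic_of p (\<lambda>_. of_nat (Suc n)) = padic_of p (\<lambda>_. of_nat n) \<oplus>\<^bsub>Qp p\<^esub> \<one>\<^bsub>Qp p\<^esub>"
      by (simp add: padic_of_one[symmetric] padic_of_add[OF p] padic_Cauchy_const add.commute)
    then show ?case using x Suc by (simp add: padic_of_closed padic_Cauchy_const l_distr)
  qed
qed

lemma image_restrict_PiE:
  "(\<lambda>u. \<lambda>i\<in>I. f i (u i)) ` (\<Pi>\<^sub>E i\<in>I. A i) = (\<Pi>\<^sub>E i\<in>I. f i ` A i)"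
proof (intro Set.set_eqI iffI)
  fix v assume v: "v \<in> (\<Pi>\<^sub>E i\<in>I. f i ` A i)"
  then have "\<forall>i\<in>I. \<exists>a. a \<in> A i \<and> v i = f i a" by (auto simp: PiE_iff)
  then obtain u where u: "\<forall>i\<in>I. u i \<in> A i \<and> v i = f i (u i)" by metis
  have "v = (\<lambda>i\<in>I. f i (restrict u I i))"
    using u v by (auto simp: fun_eq_iff PiE_iff extensional_def)
  moreover have "restrict u I \<in> (\<Pi>\<^sub>E i\<in>I. A i)" using u by auto
  ultimately show "v \<in> (\<lambda>u. \<lambda>i\<in>I. f i (u i)) ` (\<Pi>\<^sub>E i\<in>I. A i)" by blast
qed auto

text \<open>At each prime \<open>p\<close> the integer \<open>n\<close> has valuation
  \<open>multiplicity p n\<close>, so multiplying by it moves shell \<open>0\<close> to the shell of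
  that index; the image of the product is then taken coordinate by coordinate.\<close>

lemma nat_Zhat_units_eq:
  assumes n: "n > 0"
  shows "nat_Zhat_units n = (\<Pi>\<^sub>E p\<in>{p. prime p}. padic_shell p (int (multiplicity p n)))"
proof -
  let ?P = "{p::nat. prime p}"
  let ?c = "\<lambda>p. padic_of p (\<lambda>_. of_nat n)"
  have img: "(\<lambda>x. [n] \<cdot>\<^bsub>Qp p\<^esub> x) ` padic_shell p 0 = padic_shell p (int (multiplicity p n))"
    if p: "prime p" for p
  proof -
    have "?c p \<in> padic_shell p (int (multiplicity p n))"
      using padic_of_rat_in_shell[OF p, of "of_nat n"] padic_val_of_nat[OF p n] n by simp
    from padic_shell_translate[OF p this, of 0]
    show ?thesis by (auto simp: Qp_add_pow_eq[OF p] padic_shell_def Units_def image_iff)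
  qed
  have "nat_Zhat_units n = (\<lambda>u. \<lambda>p\<in>?P. [n] \<cdot>\<^bsub>Qp p\<^esub> u p) ` (\<Pi>\<^sub>E p\<in>?P. padic_shell p 0)"
    unfolding nat_Zhat_units_def Zhat_units_def
    by (rule arg_cong[where f = "image _"], rule PiE_cong) (simp add: Units_Zp)
  also have "\<dots> = (\<Pi>\<^sub>E p\<in>?P. (\<lambda>x. [n] \<cdot>\<^bsub>Qp p\<^esub> x) ` padic_shell p 0)"
    by (rule image_restrict_PiE)
  also have "\<dots> = (\<Pi>\<^sub>E p\<in>?P. padic_shell p (int (multiplicity p n)))"
    by (rule PiE_cong) (simp add: img)
  finally show ?thesis .
qed

text \<open>The shells containing the coordinates of \<open>x\<close> reveal all prime
  multiplicities, which determine the integer. So the choice of \<open>n\<close> in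
  \<open>fin_idele_fun\<close> is unique.\<close>

lemma nat_Zhat_units_inject:
  assumes "n > 0" "m > 0" "x \<in> nat_Zhat_units n" "x \<in> nat_Zhat_units m"
  shows "n = m"
proof (rule multiplicity_eq_nat)
  fix p :: nat assume p: "prime p"
  have "x p \<in> padic_shell p (int (multiplicity p n)) \<inter> padic_shell p (int (multiplicity p m))"
    using assms p by (auto simp: nat_Zhat_units_eq PiE_iff)
  then have "int (multiplicity p n) = int (multiplicity p m)"
    using padic_shell_disjoint[OF p, of "int (multiplicity p n)" "int (multiplicity p m)"] by blast
  then show "multiplicity p n = multiplicity p m" by simp
qed (use assms in auto)

text \<open>The coordinates of absolute value other than \<open>1\<close> sit exactly at the prime
  factors of \<open>n\<close>, and the product of the local values is the inverse of the prime
  factorization.\<close>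

lemma fin_idele_abs_nat_Zhat_units:
  assumes n: "n > 0" and x: "x \<in> nat_Zhat_units n"
  shows "fin_idele_abs x = 1 / real n"
proof -
  have abs: "padic_abs p (x p) = inverse (real p ^ multiplicity p n)" if "prime p" for p
    using x that by (auto simp: nat_Zhat_units_eq[OF n] PiE_iff padic_shell_def power_int_minus)
  have "{p. prime p \<and> padic_abs p (x p) \<noteq> 1} = prime_factors n"
  proof (intro Set.set_eqI iffI)
    fix p assume "p \<in> {p. prime p \<and> padic_abs p (x p) \<noteq> 1}"
    then have p: "prime p" "inverse (real p ^ multiplicity p n) \<noteq> 1" by (auto simp: abs)
    then have "multiplicity p n \<noteq> 0" by (metis inverse_1 power_0)
    then show "p \<in> prime_factors n" using p(1) by (simp add: prime_factors_multiplicity)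
  next
    fix p assume "p \<in> prime_factors n"
    then have p: "prime p" "multiplicity p n > 0" by (auto simp: prime_factors_multiplicity)
    then have "real p ^ multiplicity p n > 1"
      using prime_gt_1_nat[OF p(1)] by (intro one_less_power) auto
    then show "p \<in> {p. prime p \<and> padic_abs p (x p) \<noteq> 1}" using p(1) by (auto simp: abs)
  qed
  then have "fin_idele_abs x = (\<Prod>p\<in>prime_factors n. inverse (real p ^ multiplicity p n))"
    unfolding fin_idele_abs_def by (intro prod.cong) (auto simp: abs in_prime_factors_iff)
  also have "\<dots> = inverse (real (\<Prod>p\<in>prime_factors n. p ^ multiplicity p n))"
    by (simp add: prod_inversef[symmetric] o_def)
  also have "(\<Prod>p\<in>prime_factors n. p ^ multiplicity p n) = n"
    using prime_factorization_nat[OF n] by simp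
  finally show ?thesis by (simp add: inverse_eq_divide)
qed

text \<open>The value \<open>0\<close> marks the ideles that are not a positive integer times a unit.\<close>

definition idele_level :: "(nat \<Rightarrow> padic) \<Rightarrow> nat" where
  "idele_level x = (if \<exists>n>0. x \<in> nat_Zhat_units n then THE n. n > 0 \<and> x \<in> nat_Zhat_units n else 0)"

lemma idele_level_eq_iff:
  assumes n: "n > 0" shows "idele_level x = n \<longleftrightarrow> x \<in> nat_Zhat_units n"
proof (cases "\<exists>m>0. x \<in> nat_Zhat_units m")
  case True
  then obtain m where m: "m > 0" "x \<in> nat_Zhat_units m" by blast
  have "(THE n. n > 0 \<and> x \<in> nat_Zhat_units n) = m"
    by (rule the_equality) (use m nat_Zhat_units_inject in blast)+
  then have "idele_level x = m" unfolding idele_level_def if_P[OF True] .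
  then show ?thesis using m n nat_Zhat_units_inject by blast
next
  case False
  then show ?thesis using n unfolding idele_level_def if_not_P[OF False] by blast
qed

lemma idele_level_eq_0_iff: "idele_level x = 0 \<longleftrightarrow> (\<forall>n>0. x \<notin> nat_Zhat_units n)"
  using idele_level_eq_iff[of _ x] by (metis bot_nat_0.not_eq_extremum)

lemma fin_idele_fun_eq: "fin_idele_fun a x = (if idele_level x = 0 then 0 else a (idele_level x))"
proof (cases "\<exists>n>0. x \<in> nat_Zhat_units n")
  case True
  then have "idele_level x \<noteq> 0" by (simp add: idele_level_eq_0_iff)
  then show ?thesis unfolding fin_idele_fun_def if_P[OF True] by (simp add: idele_level_def True)
next
  case False
  then have "idele_level x = 0" using idele_level_eq_0_iff by blast
  then show ?thesis unfolding fin_idele_fun_def if_not_P[OF False] by simp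
qed

lemma fin_idele_abs_level: "idele_level x > 0 \<Longrightarrow> fin_idele_abs x = 1 / real (idele_level x)"
  using fin_idele_abs_nat_Zhat_units idele_level_eq_iff by blast

section \<open>Normalized Haar measures and the distribution of levels\<close>

locale haar_family =
  fixes \<nu> :: "nat \<Rightarrow> padic measure"
  assumes haar: "prime p \<Longrightarrow> is_haar_measure (units_of (Qp p)) (Qp_units_topology p) (\<nu> p)"
    and normalized: "prime p \<Longrightarrow> emeasure (\<nu> p) (Units (Zp p)) = 1"
begin

sublocale restricted_product "{p. prime p}" \<nu> padic_shell
proof
  fix p j k assume "p \<in> {p :: nat. prime p}"
  then have p: "prime p" by simp
  show "padic_shell p k \<in> sets (\<nu> p)" by (rule sets_haar_padic_shell[OF p haar[OF p]])
  show "j \<noteq> k \<Longrightarrow> padic_shell p j \<inter> padic_shell p k = {}" by (rule padic_shell_disjoint[OF p])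
  show "(\<Union>k. padic_shell p k) = space (\<nu> p)"
    by (simp add: padic_shell_cover[OF p] space_haar_Qp[OF p haar[OF p]])
  show "emeasure (\<nu> p) (padic_shell p k) = 1"
    by (simp add: emeasure_haar_padic_shell[OF p haar[OF p]] normalized[OF p])
qed auto

lemma points_eq_fin_ideles: "points = fin_ideles"
proof -
  have "(\<Pi>\<^sub>E p\<in>{p. prime p}. space (\<nu> p)) = (\<Pi>\<^sub>E p\<in>{p. prime p}. Units (Qp p))"
    by (rule PiE_cong) (simp add: space_haar_Qp haar)
  moreover have "{p \<in> {p. prime p}. x p \<notin> padic_shell p 0} = {p. prime p \<and> x p \<notin> Units (Zp p)}" for x
    by (auto simp: Units_Zp)
  ultimately show ?thesis unfolding points_def fin_ideles_def by simp
qed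

lemma box_measure_eq: "box_measure = fin_idele_measure \<nu>"
proof -
  have eq: "{p. p \<in> {p. prime p} \<and> U p \<noteq> padic_shell p 0} = {p. prime p \<and> U p \<noteq> Units (Zp p)}" for U
    by (auto simp: Units_Zp)
  then have "boxes = {U. (\<forall>p. prime p \<longrightarrow> U p \<in> sets (\<nu> p)) \<and> finite {p. prime p \<and> U p \<noteq> Units (Zp p)}}"
    unfolding boxes_def by simp
  then show ?thesis
    unfolding box_measure_def fin_idele_measure_def points_eq_fin_ideles eq by simp
qed

lemma nat_Zhat_units_cell:
  assumes "n > 0"
  obtains k where "k \<in> exponents" "nat_Zhat_units n = (\<Pi>\<^sub>E p\<in>{p. prime p}. padic_shell p (k p))"
proof
  \<comment> \<open>\<open>multiplicity p n\<close> can be positive at composite \<open>p\<close>,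
    hence the explicit \<open>0\<close> away from the primes.\<close>
  let ?k = "\<lambda>p. if prime p then int (multiplicity p n) else 0"
  have "{p. ?k p \<noteq> 0} = prime_factors n" by (auto simp: prime_factors_multiplicity)
  then show "?k \<in> exponents" unfolding exponents_def by (auto simp: in_prime_factors_iff)
  show "nat_Zhat_units n = (\<Pi>\<^sub>E p\<in>{p. prime p}. padic_shell p (?k p))"
    unfolding nat_Zhat_units_eq[OF assms] by (rule PiE_cong) simp
qed

lemma sets_nat_Zhat_units:
  assumes "n > 0" shows "nat_Zhat_units n \<in> sets (fin_idele_measure \<nu>)"
proof -
  obtain k where "k \<in> exponents" "nat_Zhat_units n = (\<Pi>\<^sub>E p\<in>{p. prime p}. padic_shell p (k p))"
    using nat_Zhat_units_cell[OF assms] .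
  then show ?thesis using sets_box[OF cell_in_boxes, of k] by (simp add: box_measure_eq)
qed

lemma emeasure_nat_Zhat_units:
  assumes "n > 0" shows "emeasure (fin_idele_measure \<nu>) (nat_Zhat_units n) = 1"
proof -
  obtain k where "k \<in> exponents" "nat_Zhat_units n = (\<Pi>\<^sub>E p\<in>{p. prime p}. padic_shell p (k p))"
    using nat_Zhat_units_cell[OF assms] .
  then show ?thesis using emeasure_cell[of k] by (simp add: box_measure_eq)
qed

lemma space_fin_idele_measure: "space (fin_idele_measure \<nu>) = fin_ideles"
  using space_box_measure by (simp add: box_measure_eq points_eq_fin_ideles)

lemma idele_level_vimage:
  assumes "n > 0"
  shows "idele_level -` {n} \<inter> space (fin_idele_measure \<nu>) = nat_Zhat_units n"
  using sets.sets_into_space[OF sets_nat_Zhat_units[OF assms]] idele_level_eq_iff[OF assms] by blast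

lemma measurable_idele_level: "idele_level \<in> measurable (fin_idele_measure \<nu>) (count_space UNIV)"
proof (subst measurable_count_space_eq2_countable, intro conjI ballI)
  fix n :: nat
  show "idele_level -` {n} \<inter> space (fin_idele_measure \<nu>) \<in> sets (fin_idele_measure \<nu>)"
  proof (cases "n = 0")
    case True
    \<comment> \<open>Level \<open>0\<close> is the complement of countably many measurable
      sets.\<close>
    have "idele_level -` {n} \<inter> space (fin_idele_measure \<nu>) =
        space (fin_idele_measure \<nu>) - (\<Union>m\<in>{0<..}. nat_Zhat_units m)"
      unfolding True by (auto simp: idele_level_eq_0_iff)
    also have "\<dots> \<in> sets (fin_idele_measure \<nu>)"
      by (intro sets.Diff sets.countable_UN') (auto simp: sets_nat_Zhat_units)
    finally show ?thesis .
  qed (simp add: idele_level_vimage sets_nat_Zhat_units)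
qed auto

text \<open>The fibre over a pair of positive levels is a rectangle with sides of measure
  \<open>1\<close>, so each such pair gets mass \<open>1\<close>. The restriction to
  \<open>A\<close> avoids level \<open>0\<close>, whose fibre contains every cell with a negative
  exponent and has infinite measure.\<close>

lemma distr_idele_level:
  fixes A :: "(nat \<times> nat) set"
  assumes A: "\<And>n m. (n, m) \<in> A \<Longrightarrow> n > 0 \<and> m > 0"
  defines "\<mu> \<equiv> fin_idele_measure \<nu>"
  shows "restrict_space (distr (\<mu> \<Otimes>\<^sub>M \<mu>) (count_space UNIV) (map_prod idele_level idele_level)) A
    = count_space A"
    and "map_prod idele_level idele_level \<in> measurable (\<mu> \<Otimes>\<^sub>M \<mu>) (count_space UNIV)"
proof -
  \<comment> \<open>The product formula for rectangles asks for a sigma-finite second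
    factor.\<close>
  interpret sigma_finite_measure \<mu>
    using sigma_finite_box_measure by (simp add: box_measure_eq \<mu>_def)
  note [measurable] = measurable_idele_level[folded \<mu>_def]
  have "map_prod idele_level idele_level \<in> measurable (\<mu> \<Otimes>\<^sub>M \<mu>) (count_space UNIV \<Otimes>\<^sub>M count_space UNIV)"
    unfolding map_prod_def by measurable
  then show T: "map_prod idele_level idele_level \<in> measurable (\<mu> \<Otimes>\<^sub>M \<mu>) (count_space UNIV)"
    by (simp add: pair_measure_countable)
  show "restrict_space (distr (\<mu> \<Otimes>\<^sub>M \<mu>) (count_space UNIV) (map_prod idele_level idele_level)) A
    = count_space A" (is "?N = _")
  proof (rule measure_eqI_countable)
    show "sets ?N = Pow A" by (auto simp: sets_restrict_space)
    fix z assume z: "z \<in> A"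
    obtain n m where nm: "z = (n, m)" "n > 0" "m > 0" using A z by (metis surj_pair)
    have "map_prod idele_level idele_level -` {z} \<inter> space (\<mu> \<Otimes>\<^sub>M \<mu>) =
        (idele_level -` {n} \<inter> space \<mu>) \<times> (idele_level -` {m} \<inter> space \<mu>)"
      by (auto simp: space_pair_measure nm)
    also have "\<dots> = nat_Zhat_units n \<times> nat_Zhat_units m"
      using nm by (simp add: \<mu>_def idele_level_vimage)
    finally have "emeasure (distr (\<mu> \<Otimes>\<^sub>M \<mu>) (count_space UNIV) (map_prod idele_level idele_level)) {z} = 1"
      using nm T emeasure_pair_measure_Times[of "nat_Zhat_units n" \<mu> "nat_Zhat_units m"]
      by (simp add: emeasure_distr sets_nat_Zhat_units[folded \<mu>_def]
          emeasure_nat_Zhat_units[folded \<mu>_def])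
    then show "emeasure ?N {z} = emeasure (count_space A) {z}"
      using z by (simp add: emeasure_restrict_space)
  qed auto
qed

end

section \<open>Comparison of the integral with the double series\<close>

text \<open>On positive reals the principal logarithm is the real one, so it changes sign under
  inversion without any branch correction.\<close>

lemma of_real_inverse_nat_powr:
  assumes "n > 0"
  shows "(of_real (1 / real n) :: complex) powr s = 1 / of_nat n powr s"
proof -
  have "Ln (of_real (1 / real n)) = - of_real (ln (real n))"
    using assms by (subst Ln_of_real) (auto simp: ln_div)
  then show ?thesis
    using assms by (simp add: powr_def exp_minus Ln_of_nat inverse_eq_divide)
qed

theorem theorem5p5:
  fixes F G :: "complex \<Rightarrow> complex" and k l :: int and a b :: "nat \<Rightarrow> complex"
    and s1 s2 :: complex and \<nu> :: "nat \<Rightarrow> padic measure"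
  assumes "even k" and "cusp_form k F"
    and "even l" and "cusp_form l G"
    and "\<And>\<tau>. \<tau> \<in> upper_half_plane \<Longrightarrow>
           (\<lambda>n. a (Suc n) * exp (2 * of_real pi * \<i> * of_nat (Suc n) * \<tau>)) sums F \<tau>"
    and "\<And>\<tau>. \<tau> \<in> upper_half_plane \<Longrightarrow>
           (\<lambda>n. b (Suc n) * exp (2 * of_real pi * \<i> * of_nat (Suc n) * \<tau>)) sums G \<tau>"
    and "(\<lambda>(n1, n2). norm (a n1 * b n2) / norm (of_nat n1 powr s1 * of_nat n2 powr s2))
           summable_on {(n1 :: nat, n2). 0 < n1 \<and> n1 < n2}"
    and "\<And>p. prime p \<Longrightarrow> is_haar_measure (units_of (Qp p)) (Qp_units_topology p) (\<nu> p)"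
    and "\<And>p. prime p \<Longrightarrow> emeasure (\<nu> p) (Units (Zp p)) = 1"
  defines "D \<equiv> {(x1, x2) \<in> fin_ideles \<times> fin_ideles. fin_idele_abs x1 > fin_idele_abs x2}"
    and "\<phi> \<equiv> (\<lambda>(x1, x2).
           fin_idele_fun a x1 * of_real (fin_idele_abs x1) powr s1 *
           (fin_idele_fun b x2 * of_real (fin_idele_abs x2) powr s2))"
    and "\<mu> \<equiv> fin_idele_measure \<nu>"
  shows "set_integrable (\<mu> \<Otimes>\<^sub>M \<mu>) D \<phi> \<and>
         set_lebesgue_integral (\<mu> \<Otimes>\<^sub>M \<mu>) D \<phi> =
           (\<Sum>\<^sub>\<infinity>(n1, n2)\<in>{(n1 :: nat, n2). 0 < n1 \<and> n1 < n2}.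
              a n1 * b n2 / (of_nat n1 powr s1 * of_nat n2 powr s2))"
proof -
  interpret haar_family \<nu> using assms(8,9) by unfold_locales
  let ?A = "{(n1 :: nat, n2). 0 < n1 \<and> n1 < n2}"
  let ?T = "map_prod idele_level idele_level"
  let ?h = "\<lambda>(n1, n2). a n1 * b n2 / (of_nat n1 powr s1 * of_nat n2 powr s2)"
  let ?N = "distr (\<mu> \<Otimes>\<^sub>M \<mu>) (count_space UNIV) ?T"
  have T: "?T \<in> measurable (\<mu> \<Otimes>\<^sub>M \<mu>) (count_space UNIV)"
    and N: "restrict_space ?N ?A = count_space ?A"
    unfolding \<mu>_def by (rule distr_idele_level; auto)+
  \<comment> \<open>The integrand, cut off to \<open>D\<close>, depends on an idele pair only
    through its pair of levels, so the integral can be moved to the image measure under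
    \<open>?T\<close>.\<close>
  have eq: "indicator D z *\<^sub>R \<phi> z = indicator ?A (?T z) *\<^sub>R ?h (?T z)"
    if z: "z \<in> space (\<mu> \<Otimes>\<^sub>M \<mu>)" for z
  proof -
    obtain x y where xy: "z = (x, y)" by force
    have mem: "x \<in> fin_ideles" "y \<in> fin_ideles"
      using z by (auto simp: xy space_pair_measure \<mu>_def space_fin_idele_measure)
    show ?thesis
    proof (cases "idele_level x > 0 \<and> idele_level y > 0")
      case True
      let ?n = "idele_level x" and ?m = "idele_level y"
      \<comment> \<open>The idele norm is the reciprocal of the level, so the inequality between
        norms reverses into \<open>n1 < n2\<close>.\<close>
      have "z \<in> D \<longleftrightarrow> 1 / real ?n > 1 / real ?m"
        using True mem by (simp add: D_def xy fin_idele_abs_level)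
      also have "\<dots> \<longleftrightarrow> ?T z \<in> ?A"
        using True by (simp add: xy field_simps)
      finally have "indicator D z = (indicator ?A (?T z) :: real)" by (simp add: indicator_def)
      moreover have "\<phi> z = ?h (?T z)"
        using True by (simp add: \<phi>_def xy fin_idele_fun_eq fin_idele_abs_level of_real_inverse_nat_powr
            del: of_real_divide)
      ultimately show ?thesis by simp
    next
      case False
      \<comment> \<open>If a level is \<open>0\<close>, the corresponding factor of \<phi> vanishes,
        and the right side vanishes as well because \<open>0 < n1\<close> and \<open>n1 < n2\<close>
        exclude level \<open>0\<close> in either place.\<close>
      then show ?thesis by (auto simp: \<phi>_def xy fin_idele_fun_eq)
    qed
  qed
  \<comment> \<open>The hypothesis speaks of unordered summability of norms; the equivalent notion
    used here is by definition integrability for the counting measure on \<open>?A\<close>.\<close>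
  have sum: "Infinite_Set_Sum.abs_summable_on ?h ?A"
    unfolding abs_summable_equivalent[symmetric]
    using assms(7) by (simp add: case_prod_unfold norm_divide)
  then have "integrable (restrict_space ?N ?A) ?h"
    unfolding N by (simp add: abs_summable_on_def)
  \<comment> \<open>The image measure is identified with counting measure only on \<open>?A\<close>.
    Expressing integrability there through the indicator gives a function on all pairs of levels,
    which can be pulled back along \<open>?T\<close>.\<close>
  then have int: "integrable ?N (\<lambda>w. indicator ?A w *\<^sub>R ?h w)"
    by (subst (asm) integrable_restrict_space) auto
  then have "integrable (\<mu> \<Otimes>\<^sub>M \<mu>) (\<lambda>z. indicator ?A (?T z) *\<^sub>R ?h (?T z))"
    by (subst (asm) integrable_distr_eq[OF T]) auto
  then have "set_integrable (\<mu> \<Otimes>\<^sub>M \<mu>) D \<phi>"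
    unfolding set_integrable_def by (subst Bochner_Integration.integrable_cong[OF refl eq])
  moreover have "set_lebesgue_integral (\<mu> \<Otimes>\<^sub>M \<mu>) D \<phi> = infsum ?h ?A"
  proof -
    have "set_lebesgue_integral (\<mu> \<Otimes>\<^sub>M \<mu>) D \<phi> =
        integral\<^sup>L (\<mu> \<Otimes>\<^sub>M \<mu>) (\<lambda>z. indicator ?A (?T z) *\<^sub>R ?h (?T z))"
      unfolding set_lebesgue_integral_def by (rule Bochner_Integration.integral_cong[OF refl eq])
    also have "\<dots> = integral\<^sup>L ?N (\<lambda>w. indicator ?A w *\<^sub>R ?h w)"
      by (rule integral_distr[OF T, symmetric]) auto
    also have "\<dots> = integral\<^sup>L (restrict_space ?N ?A) ?h"
      by (subst integral_restrict_space) auto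
    also have "\<dots> = infsetsum ?h ?A" unfolding N by (simp add: infsetsum_def)
    also have "\<dots> = infsum ?h ?A" by (rule infsetsum_infsum[OF sum])
    finally show ?thesis .
  qed
  ultimately show ?thesis by blast
qed

end
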